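(* For every integer $k\ge 3$, the integer $g(k)$ exists and satisfies $2k-2\le g(k)\le 8k^2+1$. Moreover, $g(3)=5$ and $g(4)=8$.
   Context: A Gallai $k$-coloring of the complete graph $K_n$ is an assignment of one of the colors $1,\dots,k$ to each edge of $K_n$ (adjacent edges may have the same color) such that no triangle has its three edges colored with three pairwise different colors. For an integer $k\ge 3$, $g(k)$ denotes the smallest positive integer $m$ with the following property: for every integer $n\ge m$ and every $k$-partition $e_1,\dots,e_k$ of $\binom{n}{2}$ (that is, all positive integers $e_1,\dots,e_k$ with $\sum_{i=1}^k e_i=\binom{n}{2}$), there is a Gallai $k$-coloring of $K_n$ with exactly $e_i$ edges of color $i$ for each $1\le i\le k$. *)

theory Defs
  imports Main "HOL-Library.FuncSet" "HOL-Library.Ramsey"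
begin

(* The vertices of K_n are 1, ..., n; an edge is a two-element set of vertices. *)
definition complete_edges :: "nat \<Rightarrow> nat set set" where
  "complete_edges n = nsets {1..n} 2"

definition rainbow_triangle :: "(nat set \<Rightarrow> nat) \<Rightarrow> nat \<Rightarrow> nat \<Rightarrow> nat \<Rightarrow> bool" where
  "rainbow_triangle c x y z \<longleftrightarrow>
     c {x, y} \<noteq> c {y, z} \<and> c {y, z} \<noteq> c {x, z} \<and> c {x, y} \<noteq> c {x, z}"

definition gallai_coloring :: "nat \<Rightarrow> nat \<Rightarrow> (nat set \<Rightarrow> nat) \<Rightarrow> bool" where
  "gallai_coloring k n c \<longleftrightarrow>
     c \<in> complete_edges n \<rightarrow> {1..k} \<and>
     (\<forall>x\<in>{1..n}. \<forall>y\<in>{1..n}. \<forall>z\<in>{1..n}.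
        x \<noteq> y \<longrightarrow> y \<noteq> z \<longrightarrow> x \<noteq> z \<longrightarrow> \<not> rainbow_triangle c x y z)"

(* A sequence e_1, ..., e_k is a function on nat of which only the values at 1, ..., k matter. *)
definition edge_partition :: "nat \<Rightarrow> nat \<Rightarrow> (nat \<Rightarrow> nat) \<Rightarrow> bool" where
  "edge_partition k n e \<longleftrightarrow> (\<forall>i\<in>{1..k}. 0 < e i) \<and> (\<Sum>i=1..k. e i) = n choose 2"

definition realizes :: "nat \<Rightarrow> nat \<Rightarrow> (nat set \<Rightarrow> nat) \<Rightarrow> (nat \<Rightarrow> nat) \<Rightarrow> bool" where
  "realizes k n c e \<longleftrightarrow> (\<forall>i\<in>{1..k}. card {a \<in> complete_edges n. c a = i} = e i)"

definition gallai_threshold :: "nat \<Rightarrow> nat \<Rightarrow> bool" where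
  "gallai_threshold k m \<longleftrightarrow> 0 < m \<and>
     (\<forall>n\<ge>m. \<forall>e. edge_partition k n e \<longrightarrow>
        (\<exists>c. gallai_coloring k n c \<and> realizes k n c e))"

(* Meaningful only if some gallai_threshold exists for k. *)
definition g :: "nat \<Rightarrow> nat" where
  "g k = (LEAST m. gallai_threshold k m)"

end

theory Submission
  imports Defs
begin

text \<open>Constructions. Joining two coloured vertex sets by a complete bipartite graph of one colour
  keeps a colouring Gallai, and two-coloured blocks may be arbitrary. For the general upper bound,
  remove stars from the least frequent colour \<open>i\<close> until \<open>r \<le> N - 2\<close> of its edges remain on \<open>N\<close>
  vertices; these fit into a block of about \<open>sqrt (2 N)\<close> vertices, completed and attached by the
  most frequent colour. This eliminates colour \<open>i\<close>, and the vertices left over are still numerous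
  enough for induction on \<open>k\<close>.

  Obstructions. A Gallai colouring either has a bipartition of the vertices all of whose crossing
  edges share a colour, or has two colours with connected spanning graphs. Hence some
  colour has at least \<open>n - 1\<close> edges, which fails on \<open>2 k - 3\<close> vertices for a balanced partition;
  and \<open>(9, 4, 4, 4)\<close> is not realizable on seven vertices.\<close>

section \<open>Colourings with prescribed edge counts\<close>

definition gallai_on :: "nat set \<Rightarrow> (nat set \<Rightarrow> nat) \<Rightarrow> bool" where
  "gallai_on V c \<longleftrightarrow> (\<forall>x\<in>V. \<forall>y\<in>V. \<forall>z\<in>V.
     x \<noteq> y \<longrightarrow> y \<noteq> z \<longrightarrow> x \<noteq> z \<longrightarrow> \<not> rainbow_triangle c x y z)"

definition color_class :: "nat set \<Rightarrow> (nat set \<Rightarrow> nat) \<Rightarrow> nat \<Rightarrow> nat set set" where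
  "color_class V c i = {a \<in> nsets V 2. c a = i}"

text \<open>The counts are prescribed for every natural number as a colour, so
  \<open>e i = 0\<close> forbids colour \<open>i\<close>. The palette is thereby encoded in the
  support of \<open>e\<close>.\<close>

definition realizable_on :: "nat set \<Rightarrow> (nat \<Rightarrow> nat) \<Rightarrow> bool" where
  "realizable_on V e \<longleftrightarrow> (\<exists>c. gallai_on V c \<and> (\<forall>i. card (color_class V c i) = e i))"

definition realizable :: "nat \<Rightarrow> (nat \<Rightarrow> nat) \<Rightarrow> bool" where
  "realizable n = realizable_on {1..n}"

lemma nsets_2_iff: "a \<in> nsets V 2 \<longleftrightarrow> (\<exists>x\<in>V. \<exists>y\<in>V. x \<noteq> y \<and> a = {x, y})"
  by (auto simp: nsets_def card_2_iff)

lemma pair_in_nsets: "{x, y} \<in> nsets V 2 \<longleftrightarrow> x \<in> V \<and> y \<in> V \<and> x \<noteq> y"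
  by (auto simp: nsets_def card_insert_if)

lemma color_class_iff: "a \<in> color_class V c i \<longleftrightarrow> (\<exists>x\<in>V. \<exists>y\<in>V. x \<noteq> y \<and> a = {x, y} \<and> c {x, y} = i)"
  by (auto simp: color_class_def nsets_2_iff)

lemma pair_in_color_class:
  "{x, y} \<in> color_class V c i \<longleftrightarrow> x \<in> V \<and> y \<in> V \<and> x \<noteq> y \<and> c {x, y} = i"
  by (simp add: color_class_def pair_in_nsets)

lemma finite_color_class [simp]: "finite V \<Longrightarrow> finite (color_class V c i)"
  by (simp add: color_class_def finite_imp_finite_nsets)

lemma gallai_onD:
  assumes "gallai_on V c" "x \<in> V" "y \<in> V" "z \<in> V" "x \<noteq> y" "y \<noteq> z" "x \<noteq> z"
  shows "c {x, y} = c {y, z} \<or> c {y, z} = c {x, z} \<or> c {x, y} = c {x, z}"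
  using assms unfolding gallai_on_def rainbow_triangle_def by blast

lemma gallai_on_subset: "gallai_on V c \<Longrightarrow> W \<subseteq> V \<Longrightarrow> gallai_on W c"
  unfolding gallai_on_def by blast

section \<open>Joins, blocks and stars\<close>

lemma realizable_on_Un:
  assumes A: "realizable_on A f" and B: "realizable_on B h"
    and fin: "finite A" "finite B" and disj: "A \<inter> B = {}"
  shows "realizable_on (A \<union> B) (\<lambda>i. f i + h i + (if i = j then card A * card B else 0))"
proof -
  obtain c1 where c1: "gallai_on A c1" "\<And>i. card (color_class A c1 i) = f i"
    using A unfolding realizable_on_def by blast
  obtain c2 where c2: "gallai_on B c2" "\<And>i. card (color_class B c2 i) = h i"
    using B unfolding realizable_on_def by blast
  define c where "c a = (if a \<subseteq> A then c1 a else if a \<subseteq> B then c2 a else j)" for a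
  have cA: "c {x, y} = c1 {x, y}" if "x \<in> A" "y \<in> A" for x y
    using that by (simp add: c_def)
  have cB: "c {x, y} = c2 {x, y}" if "x \<in> B" "y \<in> B" for x y
    using that disj by (auto simp: c_def)
  have cAB: "c {x, y} = j" "c {y, x} = j" if "x \<in> A" "y \<in> B" for x y
    using that disj by (auto simp: c_def)
  have "gallai_on (A \<union> B) c"
    unfolding gallai_on_def
  proof (intro ballI impI)
    fix x y z assume xyz: "x \<in> A \<union> B" "y \<in> A \<union> B" "z \<in> A \<union> B" "x \<noteq> y" "y \<noteq> z" "x \<noteq> z"
    consider "x \<in> A \<and> y \<in> A \<and> z \<in> A" | "x \<in> B \<and> y \<in> B \<and> z \<in> B"
      | "\<not> (x \<in> A \<and> y \<in> A \<and> z \<in> A) \<and> \<not> (x \<in> B \<and> y \<in> B \<and> z \<in> B)" by blast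
    then show "\<not> rainbow_triangle c x y z"
    proof cases
      case 1
      then show ?thesis using gallai_onD[OF c1(1), of x y z] xyz cA by (auto simp: rainbow_triangle_def)
    next
      case 2
      then show ?thesis using gallai_onD[OF c2(1), of x y z] xyz cB by (auto simp: rainbow_triangle_def)
    next
      \<comment> \<open>A triangle with vertices on both sides has exactly two crossing edges, and
        both have colour \<open>j\<close>.\<close>
      case 3
      then show ?thesis using xyz cAB by (auto simp: rainbow_triangle_def)
    qed
  qed
  moreover have "card (color_class (A \<union> B) c i) = f i + h i + (if i = j then card A * card B else 0)" for i
  proof -
    define X where "X = (if i = j then (\<lambda>(x, y). {x, y}) ` (A \<times> B) else {})"
    have eq: "color_class (A \<union> B) c i = (color_class A c1 i \<union> color_class B c2 i) \<union> X"
    proof (intro set_eqI iffI)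
      fix a assume "a \<in> color_class (A \<union> B) c i"
      then obtain x y where xy: "x \<in> A \<union> B" "y \<in> A \<union> B" "x \<noteq> y" "a = {x, y}" "c {x, y} = i"
        by (auto simp: color_class_iff)
      consider "x \<in> A \<and> y \<in> A" | "x \<in> B \<and> y \<in> B" | "x \<in> A \<and> y \<in> B" | "x \<in> B \<and> y \<in> A"
        using xy by blast
      then show "a \<in> (color_class A c1 i \<union> color_class B c2 i) \<union> X"
      proof cases
        case 1 then show ?thesis using xy cA by (auto simp: color_class_iff)
      next
        case 2 then show ?thesis using xy cB by (auto simp: color_class_iff)
      next
        case 3 then show ?thesis using xy cAB by (force simp: X_def)
      next
        case 4
        then have "i = j" "a = {y, x}" using xy cAB by auto
        with 4 have "a \<in> X" unfolding X_def by force
        then show ?thesis by blast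
      qed
    next
      fix a assume "a \<in> (color_class A c1 i \<union> color_class B c2 i) \<union> X"
      then consider "a \<in> color_class A c1 i" | "a \<in> color_class B c2 i" | "a \<in> X" by blast
      then show "a \<in> color_class (A \<union> B) c i"
      proof cases
        case 1
        then obtain x y where "x \<in> A" "y \<in> A" "x \<noteq> y" "a = {x, y}" "c1 {x, y} = i"
          by (auto simp: color_class_iff)
        then show ?thesis using cA[of x y] by (simp add: pair_in_color_class)
      next
        case 2
        then obtain x y where "x \<in> B" "y \<in> B" "x \<noteq> y" "a = {x, y}" "c2 {x, y} = i"
          by (auto simp: color_class_iff)
        then show ?thesis using cB[of x y] by (simp add: pair_in_color_class)
      next
        case 3
        then obtain x y where "x \<in> A" "y \<in> B" "a = {x, y}" "i = j"
          by (auto simp: X_def split: if_splits)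
        moreover from this have "x \<noteq> y" using disj by auto
        ultimately show ?thesis using cAB(1)[of x y] by (simp add: pair_in_color_class)
      qed
    qed
    have inj: "inj_on (\<lambda>(x, y). {x, y}) (A \<times> B)"
      using disj by (auto simp: inj_on_def doubleton_eq_iff)
    have cX: "card X = (if i = j then card A * card B else 0)"
      by (simp add: X_def card_image[OF inj] card_cartesian_product)
    have nB: "x \<notin> B" if "x \<in> A" for x using that disj by blast
    have d1: "color_class A c1 i \<inter> color_class B c2 i = {}"
      using nB by (auto simp: color_class_iff doubleton_eq_iff)
    have d2: "(color_class A c1 i \<union> color_class B c2 i) \<inter> X = {}"
      using nB by (auto simp: color_class_iff X_def doubleton_eq_iff)
    have finX: "finite X" using fin by (simp add: X_def)
    show ?thesis
      unfolding eq using fin finX d1 d2 c1(2) c2(2) cX by (simp add: card_Un_disjoint)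
  qed
  ultimately show ?thesis unfolding realizable_on_def by blast
qed

lemma realizable_on_cong_card:
  assumes "realizable_on V e" "finite V" "finite W" "card V = card W"
  shows "realizable_on W e"
proof -
  obtain c where c: "gallai_on V c" "\<And>i. card (color_class V c i) = e i"
    using assms unfolding realizable_on_def by blast
  obtain h where h: "bij_betw h W V"
    using assms by (metis finite_same_card_bij)
  have hV: "h x \<in> V" if "x \<in> W" for x using h that by (auto simp: bij_betw_def)
  have hinj: "h x = h y \<longleftrightarrow> x = y" if "x \<in> W" "y \<in> W" for x y
    using h that by (auto simp: bij_betw_def inj_on_def)
  have "gallai_on W (\<lambda>a. c (h ` a))"
    unfolding gallai_on_def
  proof (intro ballI impI)
    fix x y z assume "x \<in> W" "y \<in> W" "z \<in> W" "x \<noteq> y" "y \<noteq> z" "x \<noteq> z"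
    then show "\<not> rainbow_triangle (\<lambda>a. c (h ` a)) x y z"
      using gallai_onD[OF c(1), of "h x" "h y" "h z"] hV hinj
      by (auto simp: rainbow_triangle_def)
  qed
  moreover have "card (color_class W (\<lambda>a. c (h ` a)) i) = e i" for i
  proof -
    have "bij_betw (image h) (nsets W 2) (nsets V 2)"
      using h by (rule bij_betw_nsets)
    then have "bij_betw (image h) {a \<in> nsets W 2. c (h ` a) = i} {a \<in> nsets V 2. c a = i}"
      by (rule bij_betw_Collect) simp
    then have "card {a \<in> nsets W 2. c (h ` a) = i} = card {a \<in> nsets V 2. c a = i}"
      by (rule bij_betw_same_card)
    then show ?thesis using c(2)[of i] by (simp add: color_class_def)
  qed
  ultimately show ?thesis unfolding realizable_on_def by blast
qed

lemma realizable_join: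
  assumes "realizable m f" "realizable s h"
  shows "realizable (m + s) (\<lambda>i. f i + h i + (if i = j then m * s else 0))"
proof -
  have "realizable_on {m+1..m+s} h"
    by (rule realizable_on_cong_card[OF assms(2)[unfolded realizable_def]]) auto
  then have "realizable_on ({1..m} \<union> {m+1..m+s}) (\<lambda>i. f i + h i + (if i = j then card {1..m} * card {m+1..m+s} else 0))"
    by (intro realizable_on_Un assms(1)[unfolded realizable_def]) auto
  moreover have "{1..m} \<union> {m+1..m+s} = {1..m+s}" by auto
  moreover have "card {1..m} = m" "card {m+1..m+s} = s" by simp_all
  ultimately show ?thesis by (simp only: realizable_def)
qed

text \<open>Three pairwise different colours cannot occur when only two are available, so any set of
  \<open>p\<close> edges may serve as the class of \<open>i\<close>.\<close>

lemma realizable_two_colors: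
  assumes "i \<noteq> j" "p + q = n choose 2"
  shows "realizable n ((\<lambda>_. 0)(i := p, j := q))"
proof -
  let ?E = "nsets {1..n} 2"
  have cE: "card ?E = n choose 2" by simp
  obtain T where T: "T \<subseteq> ?E" "card T = p"
    using assms cE obtain_subset_with_card_n[of p ?E] by (metis le_add1)
  have fin: "finite ?E" by (simp add: finite_imp_finite_nsets)
  define c where "c a = (if a \<in> T then i else j)" for a
  have "gallai_on {1..n} c" by (auto simp: gallai_on_def rainbow_triangle_def c_def)
  moreover have "card (color_class {1..n} c l) = ((\<lambda>_. 0)(i := p, j := q)) l" for l
  proof -
    have "color_class {1..n} c i = T" "color_class {1..n} c j = ?E - T"
      using T assms by (auto simp: color_class_def c_def)
    moreover have "color_class {1..n} c l = {}" if "l \<noteq> i" "l \<noteq> j"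
      using that by (auto simp: color_class_def c_def)
    moreover have "card (?E - T) = q"
      using T fin cE assms by (simp add: card_Diff_subset finite_subset)
    ultimately show ?thesis using T assms by auto
  qed
  ultimately show ?thesis unfolding realizable_def realizable_on_def by blast
qed

text \<open>The basic construction: \<open>s\<close> new vertices carry \<open>p\<close> edges of
  colour \<open>i\<close> and \<open>q\<close> of colour \<open>j\<close> among themselves, and all
  \<open>m * s\<close> edges to the old vertices get colour \<open>j\<close>.\<close>

lemma realizable_block:
  assumes "realizable m f" "i \<noteq> j" "p + q = s choose 2"
  shows "realizable (m + s) (f(i := f i + p, j := f j + (m * s + q)))"
proof -
  have "f(i := f i + p, j := f j + (m * s + q)) =
    (\<lambda>l. f l + ((\<lambda>_. 0)(i := p, j := q)) l + (if l = j then m * s else 0))"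
    using assms(2) by (auto simp: fun_eq_iff)
  then show ?thesis
    using realizable_join[OF assms(1) realizable_two_colors[OF assms(2,3)]] by simp
qed

lemma realizable_peel:
  assumes "realizable m f"
  shows "realizable (Suc m) (f(j := f j + m))"
  \<comment> \<open>A star is a block with one vertex; \<open>Suc j\<close> merely stands for some
    colour different from \<open>j\<close> and receives no edges.\<close>
  using realizable_block[OF assms, of "Suc j" j 0 0 1] by simp

text \<open>Recolouring by \<open>inv \<pi>\<close> turns the class of \<open>\<pi> i\<close> into
  the class of \<open>i\<close>, and an injective recolouring neither creates nor destroys rainbow
  triangles.\<close>

lemma realizable_permute:
  assumes "realizable n e" "bij \<pi>"
  shows "realizable n (e \<circ> \<pi>)"
proof -
  obtain c where c: "gallai_on {1..n} c" "\<And>i. card (color_class {1..n} c i) = e i"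
    using assms unfolding realizable_def realizable_on_def by blast
  have inv: "inv \<pi> x = i \<longleftrightarrow> x = \<pi> i" for x i
    using assms(2) by (metis bij_inv_eq_iff)
  have "rainbow_triangle (inv \<pi> \<circ> c) x y z \<longleftrightarrow> rainbow_triangle c x y z" for x y z
    using assms(2) by (simp add: rainbow_triangle_def inj_eq bij_imp_bij_inv bij_is_inj)
  then have "gallai_on {1..n} (inv \<pi> \<circ> c)"
    using c(1) by (simp add: gallai_on_def)
  moreover have "color_class {1..n} (inv \<pi> \<circ> c) i = color_class {1..n} c (\<pi> i)" for i
    by (simp add: color_class_def inv)
  ultimately show ?thesis unfolding realizable_def realizable_on_def using c(2) by (metis comp_apply)
qed

section \<open>The general upper bound\<close>

lemma choose_2_Suc: "Suc n choose 2 = (n choose 2) + n"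
  by (simp add: numeral_2_eq_2)

lemma double_choose_2: "2 * (n choose 2) = n * (n - 1)"
proof (induction n)
  case (Suc n)
  then show ?case by (cases n) (simp_all add: choose_2_Suc)
qed simp

lemma choose_2_add: "(m + s) choose 2 = (m choose 2) + m * s + (s choose 2)"
  by (induction s) (auto simp: choose_2_Suc)

lemma realizable_peel':
  assumes "realizable m (e(j := e j - m))" "m \<le> e j"
  shows "realizable (Suc m) e"
  using realizable_peel[OF assms(1), of j] assms(2) by simp

lemma exists_color_ge_average:
  fixes e :: "nat \<Rightarrow> nat"
  assumes "finite S" "S \<noteq> {}"
  shows "\<exists>j\<in>S. sum e S \<le> card S * e j"
proof (rule ccontr)
  assume "\<not> ?thesis"
  then have *: "\<And>j. j \<in> S \<Longrightarrow> card S * e j < sum e S" by auto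
  have "(\<Sum>j\<in>S. card S * e j) < (\<Sum>j\<in>S. sum e S)"
    using assms * by (intro sum_strict_mono) auto
  then show False by (simp add: sum_distrib_left)
qed

lemma exists_color_le_average:
  fixes e :: "nat \<Rightarrow> nat"
  assumes "finite S" "S \<noteq> {}"
  shows "\<exists>j\<in>S. card S * e j \<le> sum e S"
proof (rule ccontr)
  assume "\<not> ?thesis"
  then have *: "\<And>j. j \<in> S \<Longrightarrow> sum e S < card S * e j" by auto
  have "(\<Sum>j\<in>S. sum e S) < (\<Sum>j\<in>S. card S * e j)"
    using assms * by (intro sum_strict_mono) auto
  then show False by (simp add: sum_distrib_left)
qed

text \<open>Stars of colour \<open>i\<close> with \<open>n - 1\<close>, \<open>n - 2\<close>, ...
  edges are removed for as long as this colour can pay for the next one. The process stops at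
  \<open>N\<close> vertices with \<open>r\<close> edges of colour \<open>i\<close> left; the
  equation records that exactly the edges outside a complete graph on \<open>N\<close> vertices were
  spent.\<close>

lemma peel_color_down:
  "\<exists>N r. N \<le> n \<and> (N = 0 \<or> r + 1 < N) \<and> r + (n choose 2) = e i + (N choose 2) \<and>
     (realizable N (e(i := r)) \<longrightarrow> realizable n e)"
proof (induction n arbitrary: e)
  case 0
  then show ?case by (intro exI[of _ 0] exI[of _ "e i"]) simp
next
  case (Suc n)
  show ?case
  proof (cases "e i + 1 < Suc n")
    case True
    then show ?thesis by (intro exI[of _ "Suc n"] exI[of _ "e i"]) simp
  next
    case False
    obtain N r where *: "N \<le> n" "N = 0 \<or> r + 1 < N"
      "r + (n choose 2) = (e i - n) + (N choose 2)"
      "realizable N ((e(i := e i - n))(i := r)) \<Longrightarrow> realizable n (e(i := e i - n))"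
      using Suc.IH[of "e(i := e i - n)"] by (simp only: fun_upd_same) blast
    have "realizable N (e(i := r)) \<Longrightarrow> realizable (Suc n) e"
      using * False realizable_peel'[of n e i] by simp
    then show ?thesis using * False
      by - (rule exI[of _ N], rule exI[of _ r], auto simp: choose_2_Suc fun_upd_def)
  qed
qed

text \<open>A colour with at most the average count \<open>c\<close> among \<open>q + 1\<close>
  colours leaves a fraction of at least \<open>q / (q + 1)\<close> of the edges, hence at least this
  fraction of the vertices. Now \<open>8 * (q + 1)^2 + 1\<close> times this fraction exceeds
  \<open>8 * q * (q + 1)\<close>.\<close>

lemma peeled_order_bound:
  fixes q n N c :: nat
  assumes q: "0 < q" and n: "8 * (q + 1)\<^sup>2 + 1 \<le> n" and c: "(q + 1) * c \<le> n choose 2"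
    and N: "n choose 2 \<le> c + (N choose 2)" "N \<le> n"
  shows "8 * q\<^sup>2 + 8 * q + 1 \<le> N"
proof -
  have "q * (n choose 2) \<le> (q + 1) * (N choose 2)"
  proof -
    have "(q + 1) * (n choose 2) \<le> (q + 1) * c + (q + 1) * (N choose 2)"
      using mult_le_mono2[OF N(1), of "q + 1"] by (simp add: algebra_simps)
    then show ?thesis using c by (simp add: algebra_simps)
  qed
  then have *: "q * (n * (n - 1)) \<le> (q + 1) * (N * (N - 1))"
    unfolding double_choose_2[symmetric] by (simp add: mult.left_commute)
  \<comment> \<open>Passing from edges to vertices loses only the factor
    \<open>(N - 1) / (n - 1)\<close>, which is at most 1.\<close>
  have "q * n \<le> (q + 1) * N"
  proof (rule ccontr)
    assume "\<not> ?thesis"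
    then have l: "(q + 1) * N < q * n" by simp
    have n1: "0 < n - 1" using n by (simp add: power2_eq_square)
    have "(q + 1) * N * (N - 1) \<le> (q + 1) * N * (n - 1)" using N(2) by (intro mult_le_mono) auto
    also have "\<dots> < q * n * (n - 1)" using l n1 by simp
    finally show False using * by (simp add: algebra_simps)
  qed
  then have **: "q * (8 * (q + 1)\<^sup>2 + 1) \<le> (q + 1) * N" using n by (meson le_trans mult_le_mono2)
  show ?thesis
  proof (rule ccontr)
    assume "\<not> ?thesis"
    then have "N \<le> 8 * q\<^sup>2 + 8 * q" by simp
    then have "(q + 1) * N \<le> (q + 1) * (8 * q\<^sup>2 + 8 * q)" by (rule mult_le_mono2)
    with ** have "q * (8 * (q + 1)\<^sup>2 + 1) \<le> (q + 1) * (8 * q\<^sup>2 + 8 * q)" by linarith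
    then show False using q by (simp add: power2_eq_square algebra_simps)
  qed
qed

text \<open>The block must satisfy three demands: its inner edges accommodate the \<open>r\<close>
  leftover edges, enough vertices remain outside for induction with \<open>q\<close> colours, and
  its inner and outgoing edges together are at most a \<open>q\<close>-th part of all edges, so that
  a most frequent colour can pay for them. The least \<open>s\<close> with
  \<open>N - 2 \<le> s choose 2\<close>, of size about \<open>sqrt (2 * N)\<close>, meets all
  three.\<close>

lemma exists_block_order:
  fixes q N r :: nat
  assumes N: "8 * q\<^sup>2 + 8 * q + 1 \<le> N" and r: "r + 1 < N" and q: "0 < q"
  obtains s where "r \<le> s choose 2" "s \<le> N" "8 * q\<^sup>2 + 1 \<le> N - s"
    "q * (s * (N - s) + (s choose 2)) \<le> N choose 2"
proof -
  define s where "s = (LEAST s. N - 2 \<le> s choose 2)"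
  have ex: "N - 2 \<le> N choose 2"
  proof -
    have "2 * (N - 2) \<le> N * (N - 1)" using q N by (intro mult_le_mono) auto
    then show ?thesis using double_choose_2[of N] by simp
  qed
  have s: "N - 2 \<le> s choose 2" unfolding s_def by (rule LeastI) (rule ex)
  have "0 < N - 2" using N q by simp
  have s2: "2 \<le> s"
  proof (rule ccontr)
    assume "\<not> 2 \<le> s"
    then have "s choose 2 = 0" by (intro binomial_eq_0) simp
    then show False using s \<open>0 < N - 2\<close> by linarith
  qed
  then obtain t where t: "s = t + 2" by (metis le_add_diff_inverse2)
  \<comment> \<open>Minimality of \<open>s\<close>, applied to \<open>s - 1 = t + 1\<close>, bounds
    \<open>s\<close> from above.\<close>
  have "\<not> N - 2 \<le> (t + 1) choose 2" 
    using not_less_Least[of "t + 1" "\<lambda>s. N - 2 \<le> s choose 2"] t unfolding s_def by simp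
  then have lt: "(t + 1) * t < 2 * (N - 2)" using double_choose_2[of "t + 1"] by simp
  \<comment> \<open>Otherwise \<open>t + 1\<close> would be at least \<open>8 * q\<close>, and the
    quadratic \<open>(t + 1) * t\<close> would outgrow the bound just obtained.\<close>
  have N1: "8 * q\<^sup>2 + 1 + s \<le> N"
  proof (rule ccontr)
    assume "\<not> ?thesis"
    then have a: "N < 8 * q\<^sup>2 + 3 + t" using t by simp
    then have t8: "8 * q \<le> t + 1" using N by simp
    have "(t + 1) * t < 2 * (8 * q\<^sup>2 + t + 1)" using lt a by simp
    moreover have "16 * q\<^sup>2 + 2 * (t + 1) \<le> (t + 1) * t"
    proof -
      have "16 * q\<^sup>2 + 2 * (t + 1) \<le> (t + 1) * (2 * q + 2)"
        using mult_le_mono1[OF t8, of "2 * q"] by (simp add: algebra_simps power2_eq_square)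
      also have "\<dots> \<le> (t + 1) * t" using t8 q by (intro mult_le_mono2) simp
      finally show ?thesis .
    qed
    ultimately show False by simp
  qed
  \<comment> \<open>This yields the last demand, because
    \<open>2 * (s * (N - s) + (s choose 2))\<close> is at most
    \<open>2 * s * (N - 1)\<close>.\<close>
  have N2: "2 * q * s \<le> N"
  proof (rule ccontr)
    assume "\<not> ?thesis"
    then have a: "N < 2 * q * (t + 2)" using t by simp
    then have "(t + 1) * t < 4 * q * (t + 2)" using lt by simp
    have "t \<le> 4 * q"
    proof (rule ccontr)
      assume "\<not> ?thesis"
      then have "4 * q + 1 \<le> t" by simp
      then have "(4 * q + 1) * (t + 1) \<le> t * (t + 1)" by (rule mult_le_mono1)
      then have "4 * q * (t + 1) + t + 1 < 4 * q * (t + 2)" using \<open>(t + 1) * t < 4 * q * (t + 2)\<close>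
        by (simp add: algebra_simps)
      then have "t + 1 < 4 * q" by (simp add: algebra_simps)
      then show False using \<open>4 * q + 1 \<le> t\<close> by simp
    qed
    then have "2 * q * (t + 2) \<le> 2 * q * (4 * q + 2)" by (intro mult_le_mono2) simp
    with a have "N < 2 * q * (4 * q + 2)" by (rule less_le_trans)
    then have "N < 8 * q\<^sup>2 + 4 * q" by (simp add: algebra_simps power2_eq_square)
    then show False using N by simp
  qed
  have sN: "s \<le> N" using N1 by simp
  have "2 * (q * (s * (N - s) + (s choose 2))) = q * (2 * s * (N - s) + s * (s - 1))"
    using double_choose_2[of s] by (simp add: algebra_simps)
  also have "\<dots> \<le> q * (2 * s * (N - 1))"
  proof -
    obtain m where m: "N = m + s" using sN by (metis le_add_diff_inverse2)
    show ?thesis using s2 unfolding m by (intro mult_le_mono2) (simp add: t algebra_simps)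
  qed
  also have "\<dots> \<le> N * (N - 1)" using mult_le_mono1[OF N2, of "N - 1"] by (simp add: algebra_simps)
  also have "\<dots> = 2 * (N choose 2)" by (simp add: double_choose_2)
  finally have "q * (s * (N - s) + (s choose 2)) \<le> N choose 2" by simp
  moreover have "r \<le> s choose 2" using s r by simp
  ultimately show ?thesis using that[of s] sN N1 by simp
qed

text \<open>Induction on the number of colours: a least frequent colour \<open>i\<close> is peeled
  down and its rest is put into a block that a most frequent other colour \<open>j\<close> completes
  and attaches. Counts in \<open>S\<close> may be 0, since colour \<open>j\<close> may be exhausted
  on the way, and the alternative \<open>k \<le> 2\<close> lets the induction end in two colours on
  any number of vertices.\<close>

lemma realizable_if_large:
  assumes "finite S" "card S = k" "\<And>i. i \<notin> S \<Longrightarrow> e i = 0" "sum e S = n choose 2"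
    "k \<le> 2 \<or> 8 * k\<^sup>2 + 1 \<le> n" "0 < k"
  shows "realizable n e"
  using assms
proof (induction k arbitrary: S e n)
  case 0
  then show ?case by simp
next
  case (Suc q)
  have Sfin: "finite S" "card S = Suc q" by fact+
  consider "q = 0" | "q = 1" | "2 \<le> q" by linarith
  then show ?case
  proof cases
    case 1
    then obtain i where i: "S = {i}" using Sfin card_1_singletonE by auto
    have "(\<lambda>_. 0)(Suc i := 0, i := n choose 2) = e" using Suc.prems i by (auto simp: fun_eq_iff)
    then show ?thesis using realizable_two_colors[of "Suc i" i 0 "n choose 2" n] by simp
  next
    case 2
    then obtain i j where ij: "S = {i, j}" "i \<noteq> j" using Sfin card_2_iff[of S] by auto
    have "e = (\<lambda>_. 0)(i := e i, j := e j)" using Suc.prems(3) ij by (auto simp: fun_eq_iff)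
    moreover have "e i + e j = n choose 2" using Suc.prems(4) ij by simp
    ultimately show ?thesis using realizable_two_colors[OF ij(2), of "e i" "e j" n] by simp
  next
    case 3
    then have n: "8 * (q + 1)\<^sup>2 + 1 \<le> n" using Suc.prems(5) by simp
    have "S \<noteq> {}" using Sfin by auto
    then obtain i where i: "i \<in> S" "(q + 1) * e i \<le> n choose 2"
      using exists_color_le_average[OF Sfin(1), of e] Suc.prems(4) Sfin by auto
    obtain N r where Nr: "N \<le> n" "N = 0 \<or> r + 1 < N" "r + (n choose 2) = e i + (N choose 2)"
      "realizable N (e(i := r)) \<Longrightarrow> realizable n e"
      using peel_color_down[of n e i] by blast
    have N: "8 * q\<^sup>2 + 8 * q + 1 \<le> N"
      using peeled_order_bound[OF _ n i(2), of N] Nr 3 by simp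
    then have r: "r + 1 < N" using Nr by simp
    from N r 3 obtain s where s: "r \<le> s choose 2" "s \<le> N" "8 * q\<^sup>2 + 1 \<le> N - s"
      "q * (s * (N - s) + (s choose 2)) \<le> N choose 2"
      using exists_block_order[of q N r] by (metis zero_less_numeral less_le_trans)
    define S' where "S' = S - {i}"
    have S': "finite S'" "card S' = q" "i \<notin> S'" using Sfin i by (auto simp: S'_def)
    have sum1: "e i + sum e S' = n choose 2"
      using Suc.prems(4) i Sfin by (simp add: S'_def sum.remove[of S i e])
    then have sum2: "r + sum e S' = N choose 2" using Nr by simp
    have "S' \<noteq> {}" using S' 3 by auto
    then obtain j where j: "j \<in> S'" "sum e S' \<le> q * e j"
      using exists_color_ge_average[OF S'(1), of e] S' by auto
    define w where "w = (s choose 2) - r"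
    define m where "m = N - s"
    have Nms: "N = m + s" using s by (simp add: m_def)
    have rw: "r + w = s choose 2" using s by (simp add: w_def)
    \<comment> \<open>The block inequality leaves \<open>q * r\<close> to spare on the left, which
      absorbs the \<open>r\<close> edges of colour \<open>i\<close> contained in
      \<open>N choose 2\<close>.\<close>
    have "q * (m * s + w) \<le> q * e j"
    proof -
      have "q * (m * s + w) + q * r = q * (s * (N - s) + (s choose 2))"
        by (simp add: rw[symmetric] m_def algebra_simps)
      then have "q * (m * s + w) + q * r \<le> r + sum e S'" using s(4) sum2 by simp
      moreover have "r \<le> q * r" using 3 by simp
      ultimately show ?thesis using j(2) by linarith
    qed
    then have ej: "m * s + w \<le> e j" using 3 by simp
    \<comment> \<open>The counts left outside the block: colour \<open>i\<close> has disappeared,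
      and \<open>j\<close> has paid for the attachment and for the \<open>w\<close> inner edges not
      coloured \<open>i\<close>.\<close>
    define f where "f = e(i := 0, j := e j - (m * s + w))"
    have ij: "i \<noteq> j" using j S' by auto
    have "sum f S' + (m * s + w) = sum e S'"
    proof -
      have "sum f S' = f j + sum f (S' - {j})" "sum e S' = e j + sum e (S' - {j})"
        using S' j by (auto intro: sum.remove)
      moreover have "sum f (S' - {j}) = sum e (S' - {j})"
        using S' by (intro sum.cong) (auto simp: f_def)
      ultimately show ?thesis using ej by (simp add: f_def)
    qed
    then have "sum f S' = m choose 2"
      using sum2 rw choose_2_add[of m s] unfolding Nms by simp
    moreover have "f l = 0" if "l \<notin> S'" for l
      using that Suc.prems(3) j by (auto simp: f_def S'_def)
    ultimately have "realizable m f"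
      using Suc.IH[of S' f m] S' 3 s(3) by (simp add: m_def)
    from realizable_block[OF this ij rw]
    have "realizable (m + s) (e(i := r))"
    proof -
      have "f(i := f i + r, j := f j + (m * s + w)) = e(i := r)"
        using ij ej by (auto simp: f_def fun_eq_iff)
      then show ?thesis using \<open>realizable (m + s) _\<close> by simp
    qed
    then show ?thesis using Nr(4) Nms by simp
  qed
qed

section \<open>Gallai's decomposition\<close>

text \<open>Connectivity of a colour class on all of \<open>V\<close>, phrased as: every predicate that is constant
  along its edges is constant.\<close>
definition spans :: "nat set \<Rightarrow> (nat set \<Rightarrow> nat) \<Rightarrow> nat \<Rightarrow> bool" where
  "spans V c i \<longleftrightarrow> (\<forall>P :: nat \<Rightarrow> bool. (\<forall>x\<in>V. \<forall>y\<in>V. x \<noteq> y \<longrightarrow> c {x, y} = i \<longrightarrow> P x = P y)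
      \<longrightarrow> (\<forall>x\<in>V. \<forall>y\<in>V. P x = P y))"

definition splits :: "nat set \<Rightarrow> (nat set \<Rightarrow> nat) \<Rightarrow> nat set \<Rightarrow> nat set \<Rightarrow> nat \<Rightarrow> bool" where
  "splits V c A B i \<longleftrightarrow> A \<noteq> {} \<and> B \<noteq> {} \<and> A \<inter> B = {} \<and> A \<union> B = V \<and>
      (\<forall>a\<in>A. \<forall>b\<in>B. c {a, b} = i)"

lemma spansI:
  assumes "\<And>(P :: nat \<Rightarrow> bool) x y. (\<And>x y. x \<in> V \<Longrightarrow> y \<in> V \<Longrightarrow> x \<noteq> y \<Longrightarrow> c {x, y} = i \<Longrightarrow> P x = P y) \<Longrightarrow>
    x \<in> V \<Longrightarrow> y \<in> V \<Longrightarrow> P x = P y"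
  shows "spans V c i"
  unfolding spans_def
proof (intro allI impI ballI)
  fix P :: "nat \<Rightarrow> bool" and x y
  assume "\<forall>x\<in>V. \<forall>y\<in>V. x \<noteq> y \<longrightarrow> c {x, y} = i \<longrightarrow> P x = P y" and xy: "x \<in> V" "y \<in> V"
  then show "P x = P y" by (intro assms[OF _ xy]) simp
qed

lemma spansD:
  fixes P :: "nat \<Rightarrow> bool"
  assumes "spans V c i" "x \<in> V" "y \<in> V"
    "\<And>x y. x \<in> V \<Longrightarrow> y \<in> V \<Longrightarrow> x \<noteq> y \<Longrightarrow> c {x, y} = i \<Longrightarrow> P x = P y"
  shows "P x = P y"
proof -
  have "\<forall>x\<in>V. \<forall>y\<in>V. x \<noteq> y \<longrightarrow> c {x, y} = i \<longrightarrow> P x = P y" using assms(4) by blast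
  then show ?thesis using assms(1)[unfolded spans_def, THEN spec, of P] assms(2,3) by blast
qed

lemma spans_insert:
  assumes "spans V c i" "a \<in> V" "v \<noteq> a" "c {v, a} = i"
  shows "spans (insert v V) c i"
proof (rule spansI)
  fix P :: "nat \<Rightarrow> bool" and x y
  assume P: "\<And>x y. x \<in> insert v V \<Longrightarrow> y \<in> insert v V \<Longrightarrow> x \<noteq> y \<Longrightarrow> c {x, y} = i \<Longrightarrow> P x = P y"
    and xy: "x \<in> insert v V" "y \<in> insert v V"
  have "P z = P a" if "z \<in> insert v V" for z
  proof (cases "z = v")
    case True
    then show ?thesis using P[of v a] assms by simp
  next
    case False
    then show ?thesis using that spansD[OF assms(1), of z a P] assms(2) P by simp
  qed
  then show "P x = P y" using xy by metis
qed

text \<open>A vertex outside the \<open>x\<close>-coloured component of \<open>v\<close> sees, by Gallai's condition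
  along a path of that component, one and the same colour \<open>j\<close> on all of it.\<close>
lemma spans_or_splits_if_bichromatic_vertex:
  assumes gal: "gallai_on V c" and v: "v \<in> V"
    and col: "\<And>w. w \<in> V \<Longrightarrow> w \<noteq> v \<Longrightarrow> c {v, w} = j \<or> c {v, w} = x"
  shows "spans V c x \<or> (\<exists>A B. splits V c A B j)"
proof -
  \<comment> \<open>The vertices reachable from \<open>v\<close> along edges of colour
    \<open>x\<close>. Either they exhaust \<open>V\<close>, and \<open>x\<close> spans, or
    \<open>V - C\<close> and \<open>C\<close> form the required split.\<close>
  define C where "C = {w. (v, w) \<in> {(a, b). a \<in> V \<and> b \<in> V \<and> a \<noteq> b \<and> c {a, b} = x}\<^sup>*}"
  have vC: "v \<in> C" by (simp add: C_def)
  have closed: "b \<in> C" if "a \<in> C" "a \<in> V" "b \<in> V" "a \<noteq> b" "c {a, b} = x" for a b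
    using that unfolding C_def by (auto intro: rtrancl_into_rtrancl)
  have CV: "C \<subseteq> V"
  proof
    fix w assume "w \<in> C"
    then have "(v, w) \<in> {(a, b). a \<in> V \<and> b \<in> V \<and> a \<noteq> b \<and> c {a, b} = x}\<^sup>*" by (simp add: C_def)
    then show "w \<in> V" by (induction rule: rtrancl_induct) (use v in auto)
  qed
  show ?thesis
  proof (cases "C = V")
    case True
    have "spans V c x"
    proof (rule spansI)
      fix P :: "nat \<Rightarrow> bool" and y z
      assume P: "\<And>x' y. x' \<in> V \<Longrightarrow> y \<in> V \<Longrightarrow> x' \<noteq> y \<Longrightarrow> c {x', y} = x \<Longrightarrow> P x' = P y"
        and yz: "y \<in> V" "z \<in> V"
      have "P w = P v" if "w \<in> V" for w
      proof -
        have "(v, w) \<in> {(a, b). a \<in> V \<and> b \<in> V \<and> a \<noteq> b \<and> c {a, b} = x}\<^sup>*"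
          using that True by (auto simp: C_def)
        then show ?thesis by (induction rule: rtrancl_induct) (use P in auto)
      qed
      then show "P y = P z" using yz by simp
    qed
    then show ?thesis by blast
  next
    case False
    have "c {d, w} = j" if d: "d \<in> V - C" and w: "w \<in> C" for d w
    proof -
      have "(v, w) \<in> {(a, b). a \<in> V \<and> b \<in> V \<and> a \<noteq> b \<and> c {a, b} = x}\<^sup>*" using w by (simp add: C_def)
      then show ?thesis
      proof (induction rule: rtrancl_induct)
        case base
        have "d \<noteq> v" using d vC by auto
        moreover from this have "c {v, d} \<noteq> x" using closed[OF vC v, of d] d by auto
        ultimately show ?case using col[of d] d by (auto simp: insert_commute)
      next
        case (step a b)
        have a: "a \<in> C" using step.hyps(1) by (simp add: C_def)
        have ab: "a \<in> V" "b \<in> V" "a \<noteq> b" "c {a, b} = x" using step.hyps(2) by auto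
        have b: "b \<in> C" by (rule closed) (use a ab in auto)
        have ne: "d \<noteq> a" "d \<noteq> b" using d a b by auto
        have "c {d, a} \<noteq> x" "c {d, b} \<noteq> x"
          using closed[of a d] closed[of b d] d a b ab ne by (auto simp: insert_commute)
        then show ?case using gallai_onD[OF gal, of d a b] d ab ne step.IH by auto
      qed
    qed
    then have "splits V c (V - C) C j"
      using False CV vC unfolding splits_def by blast
    then show ?thesis by blast
  qed
qed

text \<open>A vertex \<open>v\<close> is added to \<open>V\<close>, and either alternative for
  \<open>V\<close> is extended. If two colours span \<open>V\<close>, then either \<open>v\<close>
  sees both, and both still span, or \<open>v\<close> misses one of them and splits off. If
  \<open>V\<close> splits, the colours of \<open>v\<close> towards the two sides decide.\<close>

lemma gallai_splits_or_two_spanning_colors: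
  assumes "finite V" "2 \<le> card V" "gallai_on V c"
  shows "(\<exists>A B j. splits V c A B j) \<or> (\<exists>p q. p \<noteq> q \<and> spans V c p \<and> spans V c q)"
  using assms
proof (induction V rule: finite_induct)
  case empty
  then show ?case by simp
next
  case (insert v V)
  note gal = insert.prems(2)
  show ?case
  proof (cases "card V < 2")
    case True
    then have "card V = 1" using insert.prems(1) insert.hyps by simp
    then obtain a where "V = {a}" by (rule card_1_singletonE)
    then have "splits (insert v V) c {v} V (c {v, a})" using insert.hyps by (auto simp: splits_def)
    then show ?thesis by blast
  next
    case False
    have galV: "gallai_on V c" using gal by (rule gallai_on_subset) blast
    have Vne: "V \<noteq> {}" using False by auto
    have ne: "w \<noteq> v" if "w \<in> V" for w using that insert.hyps by blast
    from insert.IH[OF _ galV] False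
    consider A B j where "splits V c A B j" | p q where "p \<noteq> q" "spans V c p" "spans V c q" by auto
    then show ?thesis
    proof cases
      case (1 A B j)
      then have AB: "A \<noteq> {}" "B \<noteq> {}" "A \<inter> B = {}" "A \<union> B = V" "\<And>a b. a \<in> A \<Longrightarrow> b \<in> B \<Longrightarrow> c {a, b} = j"
        by (auto simp: splits_def)
      have AB': "c {b, a} = j" if "a \<in> A" "b \<in> B" for a b using AB(5)[OF that] by (simp add: insert_commute)
      have vAB: "v \<notin> A" "v \<notin> B" using AB(4) insert.hyps by auto
      consider "\<forall>a\<in>A. c {v, a} = j" | "\<forall>b\<in>B. c {v, b} = j"
        | a b where "a \<in> A" "b \<in> B" "c {v, a} \<noteq> j" "c {v, b} \<noteq> j" by blast
      then show ?thesis
      proof cases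
        case 1
        then have "splits (insert v V) c (insert v B) A j"
          using AB AB' vAB unfolding splits_def by auto
        then show ?thesis by blast
      next
        case 2
        then have "splits (insert v V) c (insert v A) B j"
          using AB vAB unfolding splits_def by auto
        then show ?thesis by blast
      next
        case (3 a b)
        define x where "x = c {v, a}"
        \<comment> \<open>Crossing edges have colour \<open>j\<close>, so two colours of
          \<open>v\<close> other than \<open>j\<close> towards different sides must agree. Since
          such colours occur on both sides, \<open>v\<close> sees only \<open>j\<close> and
          \<open>x\<close>.\<close>
        have tri: "c {v, a'} = j \<or> c {v, b'} = j \<or> c {v, a'} = c {v, b'}" if "a' \<in> A" "b' \<in> B" for a' b'
        proof -
          have "a' \<in> insert v V" "b' \<in> insert v V" "v \<noteq> a'" "a' \<noteq> b'" "v \<noteq> b'" using that AB vAB by auto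
          then show ?thesis using gallai_onD[OF gal, of v a' b'] AB(5)[OF that] by auto
        qed
        have xb: "c {v, b} = x" using tri[of a b] 3 by (auto simp: x_def)
        have col: "c {v, w} = j \<or> c {v, w} = x" if "w \<in> insert v V" "w \<noteq> v" for w
        proof -
          have "w \<in> A \<or> w \<in> B" using that AB(4) by auto
          then show ?thesis using tri[of w b] tri[of a w] 3 xb by (auto simp: x_def)
        qed
        show ?thesis
        proof (cases "\<forall>w\<in>V. c {v, w} = x")
          case True
          then have "splits (insert v V) c {v} V x" using Vne insert.hyps by (auto simp: splits_def)
          then show ?thesis by blast
        next
          case False
          then obtain w where w: "w \<in> V" "c {v, w} = j" using col ne by blast
          \<comment> \<open>The edges between \<open>A\<close> and \<open>B\<close> form a connected
            graph on \<open>V\<close>, and \<open>w\<close> attaches \<open>v\<close> to it. It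
            remains to find a second spanning colour \<open>x\<close> or a split, which the
            bichromatic vertex \<open>v\<close> provides.\<close>
          have "spans V c j"
          proof (rule spansI)
            fix P :: "nat \<Rightarrow> bool" and y z
            assume P: "\<And>x y. x \<in> V \<Longrightarrow> y \<in> V \<Longrightarrow> x \<noteq> y \<Longrightarrow> c {x, y} = j \<Longrightarrow> P x = P y"
              and yz: "y \<in> V" "z \<in> V"
            have *: "P a' = P b'" if "a' \<in> A" "b' \<in> B" for a' b'
            proof -
              have "a' \<noteq> b'" using that AB(3) by blast
              then show ?thesis using that P[of a' b'] AB by blast
            qed
            have "P u = P a" if "u \<in> V" for u
              using that *[OF 3(1), of u] *[of u b] *[OF 3(1,2)] 3 AB(4) by blast
            then show "P y = P z" using yz by simp
          qed
          then have "spans (insert v V) c j"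
            using w ne[OF w(1)] by (intro spans_insert[of _ _ _ w]) auto
          moreover have "spans (insert v V) c x \<or> (\<exists>A B. splits (insert v V) c A B j)"
            by (rule spans_or_splits_if_bichromatic_vertex[OF gal, of v]) (use col in auto)
          moreover have "x \<noteq> j" using 3 by (simp add: x_def)
          ultimately show ?thesis by blast
        qed
      qed
    next
      case (2 p q)
      \<comment> \<open>If \<open>v\<close> misses a spanning colour \<open>p\<close>, each edge of
        colour \<open>p\<close> in \<open>V\<close> has endpoints that \<open>v\<close> sees in the
        same colour. By connectivity \<open>v\<close> sees a single colour.\<close>
      have mono: "\<exists>A B j. splits (insert v V) c A B j" if p: "spans V c p" "\<And>w. w \<in> V \<Longrightarrow> c {v, w} \<noteq> p" for p
      proof -
        obtain a where a: "a \<in> V" using Vne by blast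
        have "c {v, w} = c {v, a}" if w: "w \<in> V" for w
        proof -
          \<comment> \<open>Connectivity is available for Boolean predicates only, here for having
            the same colour towards \<open>v\<close> as \<open>a\<close> has.\<close>
          have "(c {v, w} = c {v, a}) = (c {v, a} = c {v, a})"
          proof (rule spansD[OF p(1) w a])
            fix y z assume yz: "y \<in> V" "z \<in> V" "y \<noteq> z" "c {y, z} = p"
            have "c {v, y} = c {v, z}"
              using gallai_onD[OF gal, of v y z] yz p(2)[of y] p(2)[of z] ne[of y] ne[of z] by auto
            then show "(c {v, y} = c {v, a}) = (c {v, z} = c {v, a})" by simp
          qed
          then show ?thesis by simp
        qed
        then have "splits (insert v V) c {v} V (c {v, a})"
          using Vne insert.hyps by (auto simp: splits_def)
        then show ?thesis by blast
      qed
      show ?thesis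
      proof (cases "\<exists>a\<in>V. \<exists>b\<in>V. c {v, a} = p \<and> c {v, b} = q")
        case True
        then obtain a b where "a \<in> V" "b \<in> V" "c {v, a} = p" "c {v, b} = q" by blast
        then have "spans (insert v V) c p" "spans (insert v V) c q"
          using 2 ne by (metis spans_insert)+
        then show ?thesis using 2(1) by blast
      next
        case False
        then show ?thesis using mono[of p] mono[of q] 2 by blast
      qed
    qed
  qed
qed

section \<open>Lower bounds for colour classes, and partitions that are not realizable\<close>

lemma color_class_mono: "V \<subseteq> W \<Longrightarrow> color_class V c i \<subseteq> color_class W c i"
  by (auto simp: color_class_def nsets_def)

text \<open>The usual bound for the number of edges of a connected graph: a vertex set is grown one
  vertex at a time, and each new vertex brings at least one new edge of colour
  \<open>i\<close>.\<close>

lemma spans_card_ge: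
  assumes "finite V" "spans V c i" "V \<noteq> {}"
  shows "card V \<le> card (color_class V c i) + 1"
proof -
  have "\<exists>S\<subseteq>V. card S = Suc m \<and> m \<le> card (color_class S c i)" if "Suc m \<le> card V" for m
    using that
  proof (induction m)
    case 0
    obtain a where "a \<in> V" using assms by blast
    then show ?case by (intro exI[of _ "{a}"]) auto
  next
    case (Suc m)
    then obtain S where S: "S \<subseteq> V" "card S = Suc m" "m \<le> card (color_class S c i)" by auto
    have Sfin: "finite S" using S assms finite_subset by blast
    have "S \<noteq> V" using S Suc.prems by auto
    then obtain z where z: "z \<in> V" "z \<notin> S" using S by blast
    obtain s where s: "s \<in> S" using S by fastforce
    obtain x y where xy: "x \<in> V" "y \<in> V" "c {x, y} = i" "x \<in> S" "y \<notin> S"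
    proof (rule ccontr)
      assume n: "\<not> thesis"
      \<comment> \<open>If no edge of colour \<open>i\<close> left \<open>S\<close>, membership in
        \<open>S\<close> would be constant along these edges and hence on \<open>V\<close>.\<close>
      have "(s \<in> S) = (z \<in> S)"
      proof (rule spansD[OF assms(2)])
        fix x y assume "x \<in> V" "y \<in> V" "c {x, y} = i"
        then show "(x \<in> S) = (y \<in> S)" using n that by (metis insert_commute)
      qed (use s S z in auto)
      then show False using s z by simp
    qed
    have "x \<noteq> y" using xy by auto
    then have "insert {x, y} (color_class S c i) \<subseteq> color_class (insert y S) c i"
      using xy color_class_mono[of S "insert y S" c i] by (auto simp: pair_in_color_class)
    then have "card (insert {x, y} (color_class S c i)) \<le> card (color_class (insert y S) c i)"
      using Sfin by (intro card_mono) auto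
    moreover have "{x, y} \<notin> color_class S c i" using xy by (simp add: pair_in_color_class)
    ultimately have "Suc m \<le> card (color_class (insert y S) c i)" using S Sfin by simp
    then show ?case using S xy Sfin by (intro exI[of _ "insert y S"]) auto
  qed
  from this[of "card V - 1"] obtain S where S: "S \<subseteq> V" "card S = card V" "card V - 1 \<le> card (color_class S c i)"
    using assms by (metis Suc_pred' card_gt_0_iff order_refl)
  then have "S = V" using assms(1) card_subset_eq by blast
  then show ?thesis using S by simp
qed

lemma splits_card_ge:
  assumes "finite V" "splits V c A B i"
  shows "card A * card B \<le> card (color_class V c i)" "card A + card B = card V"
    "0 < card A" "0 < card B"
proof -
  have fin: "finite A" "finite B" and dis: "A \<inter> B = {}" and V: "V = A \<union> B"
    using assms by (auto simp: splits_def)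
  have nB: "x \<notin> B" if "x \<in> A" for x using that dis by blast
  have "inj_on (\<lambda>(x, y). {x, y}) (A \<times> B)"
    using nB by (auto simp: inj_on_def doubleton_eq_iff)
  then have "card A * card B = card ((\<lambda>(x, y). {x, y}) ` (A \<times> B))"
    by (simp add: card_image card_cartesian_product)
  also have "\<dots> \<le> card (color_class V c i)"
  proof (rule card_mono)
    show "(\<lambda>(x, y). {x, y}) ` (A \<times> B) \<subseteq> color_class V c i"
    proof
      fix e assume "e \<in> (\<lambda>(x, y). {x, y}) ` (A \<times> B)"
      then obtain x y where "x \<in> A" "y \<in> B" "e = {x, y}" by auto
      moreover from this have "x \<noteq> y" using nB by auto
      ultimately show "e \<in> color_class V c i"
        using assms(2) by (simp add: pair_in_color_class splits_def) blast
    qed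
  qed (use assms in simp)
  finally show "card A * card B \<le> card (color_class V c i)" .
  show "card A + card B = card V" using fin dis V by (simp add: card_Un_disjoint)
  show "0 < card A" "0 < card B" using fin assms(2) by (auto simp: splits_def card_gt_0_iff)
qed

lemma gallai_color_card_ge:
  assumes "finite V" "2 \<le> card V" "gallai_on V c"
  shows "\<exists>i. card V \<le> card (color_class V c i) + 1"
proof -
  have "V \<noteq> {}" using assms by auto
  from gallai_splits_or_two_spanning_colors[OF assms]
  consider A B j where "splits V c A B j" | p where "spans V c p" by blast
  then show ?thesis
  proof cases
    case (1 A B j)
    note * = splits_card_ge[OF assms(1) 1]
    \<comment> \<open>For positive sizes the product is at least the sum minus 1.\<close>
    then obtain a b where "card A = Suc a" "card B = Suc b" by (metis gr0_implies_Suc)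
    then have "card V \<le> card A * card B + 1" using *(2) by simp
    then show ?thesis using *(1) by (intro exI[of _ j]) simp
  next
    case (2 p)
    then show ?thesis using spans_card_ge assms \<open>V \<noteq> {}\<close> by blast
  qed
qed

lemma not_realizable_if_small:
  assumes "2 \<le> n" "\<And>i. e i + 1 < n"
  shows "\<not> realizable n e"
proof
  assume "realizable n e"
  then obtain c where "gallai_on {1..n} c" "\<And>i. card (color_class {1..n} c i) = e i"
    unfolding realizable_def realizable_on_def by blast
  with gallai_color_card_ge[of "{1..n}" c] show False
    using assms by (auto simp: not_le[symmetric])
qed

text \<open>Two spanning colours would both need at least six edges, so there is a split. Its 6, 10
  or 12 crossing edges fit only into colour \<open>i\<close>, and only 6 do, so one side is a single
  vertex. The other six vertices then need a colour with at least five edges, again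
  \<open>i\<close>, but 6 + 5 exceeds 9.\<close>

lemma not_realizable_9444:
  assumes "i \<noteq> j" "i \<noteq> k" "i \<noteq> l" "j \<noteq> k" "j \<noteq> l" "k \<noteq> l"
  shows "\<not> realizable 7 ((\<lambda>_. 0)(i := 9, j := 4, k := 4, l := 4))"
proof
  define e :: "nat \<Rightarrow> nat" where "e = (\<lambda>_. 0)(i := 9, j := 4, k := 4, l := 4)"
  assume "realizable 7 ((\<lambda>_. 0)(i := 9, j := 4, k := 4, l := 4))"
  then obtain c where c: "gallai_on {1..7} c" "\<And>m. card (color_class {1..7} c m) = e m"
    unfolding realizable_def realizable_on_def e_def by blast
  have ei: "e i = 9" using assms by (simp add: e_def)
  have en: "e m \<le> 4" if "m \<noteq> i" for m using that by (simp add: e_def)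
  have "\<not> (p \<noteq> q \<and> spans {1..7} c p \<and> spans {1..7} c q)" for p q
    using spans_card_ge[of "{1..7}" c p] spans_card_ge[of "{1..7}" c q] en[of p] en[of q] c(2) by force
  then obtain A B m where spl: "splits {1..7} c A B m"
    using gallai_splits_or_two_spanning_colors[OF _ _ c(1)] by (simp del: One_nat_def) blast
  note * = splits_card_ge[OF _ spl, simplified]
  \<comment> \<open>Excludes a vertex \<open>v\<close> joined to the six others in colour
    \<open>i\<close>.\<close>
  have key: False if X: "X \<subseteq> {1..7}" "card X = 6" "v \<in> {1..7} - X" "\<And>w. w \<in> X \<Longrightarrow> c {v, w} = i" for X v
  proof -
    have finX: "finite X" using X(1) finite_subset by blast
    have "gallai_on X c" using gallai_on_subset[OF c(1) X(1)] .
    then obtain p where p: "6 \<le> card (color_class X c p) + 1"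
      using gallai_color_card_ge[OF finX] X(2) by auto
    have sub: "color_class X c p \<subseteq> color_class {1..7} c p" using X(1) by (rule color_class_mono)
    then have "card (color_class X c p) \<le> e p" using c(2) by (metis card_mono finite_atLeastAtMost finite_color_class)
    then have pi: "p = i" using p en[of p] by (cases "p = i") auto
    have "(\<lambda>w. {v, w}) ` X \<union> color_class X c i \<subseteq> color_class {1..7} c i"
      using X sub pi by (auto simp: pair_in_color_class)
    then have "card ((\<lambda>w. {v, w}) ` X \<union> color_class X c i) \<le> 9"
      using c(2)[of i] ei by (metis card_mono finite_atLeastAtMost finite_color_class)
    moreover have "card ((\<lambda>w. {v, w}) ` X \<union> color_class X c i) = 6 + card (color_class X c i)"
    proof -
      have "inj_on (\<lambda>w. {v, w}) X" by (auto simp: inj_on_def doubleton_eq_iff)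
      moreover have "(\<lambda>w. {v, w}) ` X \<inter> color_class X c i = {}"
        using X(3) by (auto simp: pair_in_color_class)
      ultimately show ?thesis using finX X(2) by (simp add: card_Un_disjoint card_image)
    qed
    ultimately show False using p pi by simp
  qed
  have prod: "card A * card B \<le> e m" using *(1) c(2)[of m] by simp
  have cases: "card A \<in> {1,2,3,4,5,6}" using *(2,3,4) by auto
  have B: "card B = 7 - card A" using *(2) by simp
  have mi: "m = i"
    using prod cases B en[of m] by (cases "m = i") auto
  have un: "A \<union> B = {1..7}" "A \<inter> B = {}" and cross: "\<And>a b. a \<in> A \<Longrightarrow> b \<in> B \<Longrightarrow> c {a, b} = i"
    using spl mi by (simp_all add: splits_def)
  consider "card A = 1" "card B = 6" | "card A = 6" "card B = 1" using prod cases B mi ei by auto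
  then show False
  proof cases
    case 1
    then obtain v where v: "A = {v}" using card_1_singletonE by auto
    then have "B \<subseteq> {1..7}" "v \<in> {1..7} - B" using un by blast+
    then show False using key[of B v] cross v 1 by simp
  next
    case 2
    then obtain v where v: "B = {v}" using card_1_singletonE by auto
    then have "c {v, w} = i" if "w \<in> A" for w using cross[of w v] that by (simp add: insert_commute)
    moreover have "A \<subseteq> {1..7}" "v \<in> {1..7} - A" using un v by blast+
    ultimately show False using key[of A v] 2 by simp
  qed
qed

section \<open>Three and four colours\<close>

definition four_colors :: "nat \<Rightarrow> nat \<Rightarrow> nat \<Rightarrow> nat \<Rightarrow> nat \<Rightarrow> nat" where
  "four_colors a b c d = (\<lambda>_. 0)(1 := a, 2 := b, 3 := c, 4 := d)"

text \<open>With the counts as separate arguments, permuting colours means permuting arguments;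
  three colours are the case \<open>d = 0\<close>.\<close>

definition realizable4 :: "nat \<Rightarrow> nat \<Rightarrow> nat \<Rightarrow> nat \<Rightarrow> nat \<Rightarrow> bool" where
  "realizable4 n a b c d \<longleftrightarrow> realizable n (four_colors a b c d)"

lemma realizable_transpose:
  "realizable n e \<Longrightarrow> realizable n (e(i := e j, j := e i))"
proof -
  assume "realizable n e"
  then have "realizable n (e \<circ> (id(i := j, j := i)))"
    by (rule realizable_permute) (rule involuntory_imp_bij, simp)
  moreover have "e \<circ> (id(i := j, j := i)) = e(i := e j, j := e i)" by (auto simp: fun_eq_iff)
  ultimately show ?thesis by simp
qed

lemma realizable4_swap:
  "realizable4 n a b c d \<Longrightarrow> realizable4 n b a c d"
  "realizable4 n a b c d \<Longrightarrow> realizable4 n a c b d"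
  "realizable4 n a b c d \<Longrightarrow> realizable4 n a b d c"
proof -
  assume h: "realizable4 n a b c d"
  have *: "(four_colors a b c d)(1 := b, 2 := a) = four_colors b a c d"
    "(four_colors a b c d)(2 := c, 3 := b) = four_colors a c b d"
    "(four_colors a b c d)(3 := d, 4 := c) = four_colors a b d c"
    by (auto simp: four_colors_def fun_eq_iff)
  show "realizable4 n b a c d"
    using realizable_transpose[OF h[unfolded realizable4_def], of 1 2] * by (simp add: realizable4_def four_colors_def)
  show "realizable4 n a c b d"
    using realizable_transpose[OF h[unfolded realizable4_def], of 2 3] * by (simp add: realizable4_def four_colors_def)
  show "realizable4 n a b d c"
    using realizable_transpose[OF h[unfolded realizable4_def], of 3 4] * by (simp add: realizable4_def four_colors_def)
qed

lemma realizable4_perm: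
  "realizable4 n a b c d \<longleftrightarrow> realizable4 n b a c d"
  "realizable4 n a b c d \<longleftrightarrow> realizable4 n a c b d"
  "realizable4 n a b c d \<longleftrightarrow> realizable4 n a b d c"
  using realizable4_swap by blast+

lemma realizable4_block:
  assumes "realizable4 m (a - (m * s + q)) (b - p) c d" "m * s + q \<le> a" "p \<le> b" "p + q = s choose 2"
  shows "realizable4 (m + s) a b c d"
proof -
  have "(four_colors (a - (m * s + q)) (b - p) c d)(2 := b, 1 := a) = four_colors a b c d"
    by (auto simp: four_colors_def fun_eq_iff)
  then show ?thesis
    using realizable_block[OF assms(1)[unfolded realizable4_def], of 2 1 p q s] assms(2-4)
    by (simp add: realizable4_def four_colors_def)
qed

lemma realizable4_peel:
  assumes "realizable4 m (a - m) b c d" "m \<le> a"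
  shows "realizable4 (Suc m) a b c d"
  using realizable4_block[of m a 1 0 b 0 c d] assms by simp

lemma realizable4_peel2:
  assumes "realizable4 m a (b - m) c d" "m \<le> b"
  shows "realizable4 (Suc m) a b c d"
  using realizable4_peel[of m b a c d] assms by (simp add: realizable4_perm)

lemma realizable4_peel3:
  assumes "realizable4 m a b (c - m) d" "m \<le> c"
  shows "realizable4 (Suc m) a b c d"
  using realizable4_peel2[of m a c b d] assms realizable4_perm(2) by blast

lemma realizable4_peel4:
  assumes "realizable4 m a b c (d - m)" "m \<le> d"
  shows "realizable4 (Suc m) a b c d"
  using realizable4_peel3[of m a b d c] assms realizable4_perm(3) by blast

lemma realizable4_two: "a + b = n choose 2 \<Longrightarrow> realizable4 n a b 0 0"
proof -
  assume "a + b = n choose 2"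
  moreover have "(\<lambda>_. 0)(1 := a, 2 := b) = four_colors a b 0 0"
    by (auto simp: four_colors_def fun_eq_iff)
  ultimately show ?thesis using realizable_two_colors[of 1 2 a b n] by (simp add: realizable4_def)
qed

text \<open>Insertion sort on the four counts: adjacent transpositions preserve both
  \<open>P\<close> and realizability, so decreasing counts suffice.\<close>

lemma realizable4_sorted_cases:
  assumes "\<And>a b c d. b \<le> a \<Longrightarrow> c \<le> b \<Longrightarrow> d \<le> c \<Longrightarrow> P a b c d \<Longrightarrow> realizable4 n a b c d"
    and P: "\<And>a b c d. P a b c d \<Longrightarrow> P b a c d" "\<And>a b c d. P a b c d \<Longrightarrow> P a c b d"
      "\<And>a b c d. P a b c d \<Longrightarrow> P a b d c"
    and "P a b c d"
  shows "realizable4 n a b c d"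
proof -
  have P': "P b a c d \<longleftrightarrow> P a b c d" "P a c b d \<longleftrightarrow> P a b c d" "P a b d c \<longleftrightarrow> P a b c d" for a b c d
    using P by blast+
  have ins3: "realizable4 n a b c d" if "c \<le> b" "d \<le> c" "P a b c d" for a b c d
  proof -
    consider "b \<le> a" | "a \<le> b" "c \<le> a" | "a \<le> c" "d \<le> a" | "a \<le> d" by linarith
    then show ?thesis
    proof cases
      case 1 then show ?thesis using assms(1) that by blast
    next
      case 2 then show ?thesis using assms(1)[of a b c d] that realizable4_perm(1) P' by blast
    next
      case 3 then have "realizable4 n b c a d" using that by (intro assms(1)) (auto simp: P')
      then show ?thesis using realizable4_perm by blast
    next
      case 4 then have "realizable4 n b c d a" using that P' by (intro assms(1)) blast+
      then show ?thesis using realizable4_perm by blast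
    qed
  qed
  have ins2: "realizable4 n a b c d" if "d \<le> c" "P a b c d" for a b c d
  proof -
    consider "c \<le> b" | "b \<le> c" "d \<le> b" | "b \<le> d" using that by linarith
    then show ?thesis
    proof cases
      case 1 then show ?thesis using ins3 that by blast
    next
      case 2
      then have "realizable4 n a c b d" using that P' by (intro ins3) blast+
      then show ?thesis using realizable4_perm by blast
    next
      case 3
      then have "realizable4 n a c d b" using that P' by (intro ins3) blast+
      then show ?thesis using realizable4_perm by blast
    qed
  qed
  show ?thesis
  proof (cases "d \<le> c")
    case True then show ?thesis using ins2 assms by blast
  next
    case False
    then have "realizable4 n a b d c" using assms(5) P' by (intro ins2) auto
    then show ?thesis using realizable4_perm by blast
  qed
qed

section \<open>Three colours\<close>

lemma realizable4_three_4:
  assumes "a + b + c = 6" "\<not> (a = 2 \<and> b = 2 \<and> c = 2)"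
  shows "realizable4 4 a b c 0"
proof -
  have K3: "realizable4 3 a b c 0" if "a + b + c = 3" "\<not> (a = 1 \<and> b = 1 \<and> c = 1)" for a b c
  proof -
    have two: "realizable4 3 x y 0 0" if "x + y = 3" for x y
      using realizable4_two[of x y 3] that by (simp add: choose_two)
    \<comment> \<open>On three vertices only (1, 1, 1) uses all three colours.\<close>
    have "a = 0 \<or> b = 0 \<or> c = 0" using that by presburger
    then show ?thesis using two[of b c] two[of a c] two[of a b] that(1) realizable4_perm by auto
  qed
  have big: "realizable4 4 a b c 0" if "a + b + c = 6" "3 \<le> a" for a b c
  \<comment> \<open>A star of the first colour works unless it leaves (1, 1, 1). The exception (4,
    1, 1) is a 4-cycle \<open>K(2, 2)\<close> of the first colour between two single edges of the
    other colours.\<close>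
  proof (cases "a = 4 \<and> b = 1 \<and> c = 1")
    case True
    have "realizable4 2 0 0 1 0"
      using realizable4_two[of 1 0 2] by (simp add: choose_two realizable4_perm)
    then show ?thesis using realizable4_block[of 2 4 2 0 1 1 1 0] True by (simp add: choose_two)
  next
    case False
    then have "\<not> (a - 3 = 1 \<and> b = 1 \<and> c = 1)" using that by presburger
    then show ?thesis using realizable4_peel[of 3 a b c 0] K3[of "a - 3" b c] that by (simp add: eval_nat_numeral)
  qed
  have "3 \<le> a \<or> 3 \<le> b \<or> 3 \<le> c" using assms by presburger
  then show ?thesis
    using big[of a b c] big[of b a c] big[of c a b] assms(1) realizable4_perm
    by (auto simp: add.commute add.left_commute)
qed

lemma realizable4_three:
  assumes "5 \<le> n" "a + b + c = n choose 2"
  shows "realizable4 n a b c 0"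
  using assms
proof (induction n arbitrary: a b c rule: dec_induct)
  case base
  have big: "realizable4 5 a b c 0" if "a + b + c = 10" "4 \<le> a" for a b c
  \<comment> \<open>A star would leave (2, 2, 2) on four vertices. Instead, the six edges become
    \<open>K(2, 3)\<close>, with one edge of the second colour inside the pair.\<close>
  proof (cases "a = 6 \<and> b = 2 \<and> c = 2")
    case True
    have "realizable4 3 0 1 2 0"
      using realizable4_two[of 1 2 3] by (simp add: choose_two realizable4_perm)
    then show ?thesis using realizable4_block[of 3 6 2 0 2 1 2 0] True by (simp add: choose_two)
  next
    case False
    then have "realizable4 4 (a - 4) b c 0" using that by (intro realizable4_three_4) auto
    then show ?thesis using realizable4_peel[of 4 a b c 0] that by simp
  qed
  have s: "a + b + c = 10" using base by (simp add: choose_two)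
  then consider "4 \<le> a" | "4 \<le> b" | "4 \<le> c" by linarith
  then show ?case
    using big[of a b c] big[of b a c] big[of c a b] s realizable4_perm
    by cases (auto simp: add.commute add.left_commute)
next
  case (step n)
  have s: "a + b + c = (n choose 2) + n" using step.prems by (simp add: choose_2_Suc)
  \<comment> \<open>Pigeonhole: if all three counts were at most \<open>n - 1\<close>, their sum
    would be too small, so some colour has a star to remove.\<close>
  have "3 * n \<le> (n choose 2) + n + 2"
  proof -
    have "n * 4 \<le> n * (n - 1)" using step.hyps by (intro mult_le_mono) auto
    then show ?thesis using double_choose_2[of n] by linarith
  qed
  then consider "n \<le> a" | "n \<le> b" | "n \<le> c" using s by linarith
  then show ?case
  proof cases
    case 1
    then show ?thesis using step.IH[of "a - n" b c] s by (intro realizable4_peel) auto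
  next
    case 2
    then show ?thesis using step.IH[of a "b - n" c] s by (intro realizable4_peel2) auto
  next
    case 3
    then show ?thesis using step.IH[of a b "c - n"] s by (intro realizable4_peel3) auto
  qed
qed

lemma realizable4_first_zero:
  assumes "5 \<le> n" "b + c + d = n choose 2"
  shows "realizable4 n 0 b c d"
  using realizable4_three[OF assms] realizable4_perm by metis

section \<open>Four colours on eight and more vertices\<close>

lemma choose_2_numeral:
  "(1::nat) choose 2 = 0" "(2::nat) choose 2 = 1" "(3::nat) choose 2 = 3" "(4::nat) choose 2 = 6"
  "(5::nat) choose 2 = 10" "(6::nat) choose 2 = 15" "(7::nat) choose 2 = 21" "(8::nat) choose 2 = 28"
  by (simp_all add: choose_two)

text \<open>By pigeonhole one of the last three colours can pay for a star, so the count of the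
  first colour stays intact for later use.\<close>

lemma realizable4_peel_others:
  assumes "\<And>b c d. b + c + d + m = s \<Longrightarrow> realizable4 m a b c d" "b + c + d = s" "3 * m \<le> s + 2"
  shows "realizable4 (Suc m) a b c d"
proof -
  consider "m \<le> b" | "m \<le> c" | "m \<le> d" using assms(2,3) by linarith
  then show ?thesis
  proof cases
    case 1
    then show ?thesis using assms by (intro realizable4_peel2 assms(1)) auto
  next
    case 2
    then show ?thesis using assms by (intro realizable4_peel3 assms(1)) auto
  next
    case 3
    then show ?thesis using assms by (intro realizable4_peel4 assms(1)) auto
  qed
qed

text \<open>The listed numbers of edges are used up exactly by stars and the complete bipartite graph
  \<open>K(2, 5)\<close> on at most three vertices; on the remaining five or more vertices three colours always
  suffice.\<close>
lemma realizable4_8_if_exact: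
  assumes sum: "a + b + c + d = 28"
    and a: "a \<in> {0, 5, 6, 7, 10, 11, 12, 13}"
  shows "realizable4 8 a b c d"
proof -
  have z5: "realizable4 5 0 b c d" if "b + c + d = 10" for b c d
    using realizable4_first_zero[of 5 b c d] that by (simp add: choose_2_numeral)
  have z6: "realizable4 6 0 b c d" if "b + c + d = 15" for b c d
    using realizable4_first_zero[of 6 b c d] that by (simp add: choose_2_numeral)
  have z7: "realizable4 7 0 b c d" if "b + c + d = 21" for b c d
    using realizable4_first_zero[of 7 b c d] that by (simp add: choose_2_numeral)
  have r6: "realizable4 6 5 b c d" if "b + c + d = 10" for b c d
    using realizable4_peel[of 5 5 b c d] z5[OF that] by simp
  have r7: "realizable4 7 6 b c d" if "b + c + d = 15" for b c d
    using realizable4_peel[of 6 6 b c d] z6[OF that] by simp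
  have r75: "realizable4 7 5 b c d" if "b + c + d = 16" for b c d
    using realizable4_peel_others[of 6 16 5 b c d] r6 that by simp
  have r711: "realizable4 7 11 b c d" if "b + c + d = 10" for b c d
    using realizable4_peel[of 6 11 b c d] r6[OF that] by simp
  \<comment> \<open>Ten edges are \<open>K(2, 5)\<close>; the edge inside the pair goes to any other
    colour that still occurs.\<close>
  have r710: "realizable4 7 10 b c d" if s: "b + c + d = 11" for b c d
  proof -
    have *: "realizable4 7 10 b c d" if "0 < b" "b + c + d = 11" for b c d
      using realizable4_block[of 5 10 2 0 b 1 c d] z5[of "b - 1" c d] that by (simp add: choose_2_numeral)
    consider "0 < b" | "0 < c" | "0 < d" using s by linarith
    then show ?thesis
      using *[of b c d] *[of c b d] *[of d b c] s realizable4_perm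
      by cases (auto simp: add.commute add.left_commute)
  qed
  have six: "realizable4 8 6 b c d" if "b + c + d = 22" for b c d
    using realizable4_peel_others[of 7 22 6 b c d] r7 that by simp
  have peel7: "realizable4 8 a b c d"
    if r: "\<And>b c d. b + c + d + 7 = s \<Longrightarrow> realizable4 7 a b c d"
      and s: "b + c + d = s" "17 \<le> s" "a + s = 28" for a b c d s
  proof -
    \<comment> \<open>Counts of at most 5 would sum to at most 15. A count of 6 is handled by
      \<open>six\<close> with that colour in first place.\<close>
    have "7 \<le> b \<or> 7 \<le> c \<or> 7 \<le> d \<or> b = 6 \<or> c = 6 \<or> d = 6"
      using s by presburger
    then consider "7 \<le> b" | "7 \<le> c" | "7 \<le> d" | "b = 6 \<or> c = 6 \<or> d = 6" by blast
    then show ?thesis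
    proof cases
      case 1 then show ?thesis using realizable4_peel2[of 7 a b c d] r s by simp
    next
      case 2 then show ?thesis using realizable4_peel3[of 7 a b c d] r s by simp
    next
      case 3 then show ?thesis using realizable4_peel4[of 7 a b c d] r s by simp
    next
      case 4 then show ?thesis
        using six[of a c d] six[of a b d] six[of a b c] s realizable4_perm
        by (auto simp: add.commute add.left_commute)
    qed
  qed
  from a consider "a = 0" | "a = 5" | "a = 6" | "a = 7" | "a = 10" | "a = 11" | "a = 12" | "a = 13" by auto
  then show ?thesis
  proof cases
    case 1 then show ?thesis using realizable4_first_zero[of 8 b c d] sum by (simp add: choose_2_numeral)
  next
    case 2 then show ?thesis using peel7[of 23 5 b c d] r75 sum by simp
  next
    case 3 then show ?thesis using six sum by simp
  next
    case 4 then show ?thesis using realizable4_peel[of 7 7 b c d] z7[of b c d] sum by simp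
  next
    case 5 then show ?thesis using peel7[of 18 10 b c d] r710 sum by simp
  next
    case 6 then show ?thesis using peel7[of 17 11 b c d] r711 sum by simp
  next
    case 7 then show ?thesis using realizable4_peel[of 7 12 b c d] r75[of b c d] sum by simp
  next
    case 8 then show ?thesis using realizable4_peel[of 7 13 b c d] r7[of b c d] sum by simp
  qed
qed

text \<open>Three vertices are joined to the other five by \<open>K(3, 5)\<close>, 15 edges of the
  first colour. The triangle inside is used to exhaust a colour: \<open>small\<close> places all of
  a colour with at most three edges there, \<open>exact\<close> the remaining \<open>a - 15\<close>
  edges of the first. Three colours suffice on the other five vertices.\<close>

lemma realizable4_8_if_ge_15:
  assumes sum: "a + b + c + d = 28" and a: "15 \<le> a"
  shows "realizable4 8 a b c d"
proof -
  have K5: "realizable4 5 a b c d" if "a = 0 \<or> b = 0" "a + b + c + d = 10" for a b c d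
    using realizable4_first_zero[of 5 b c d] realizable4_first_zero[of 5 a c d] that realizable4_perm(1)[of 5 a b c d]
    by (auto simp: choose_2_numeral)
  have small: "realizable4 8 a b c d" if "18 \<le> a + b" "b \<le> 3" "a + b + c + d = 28" for a b c d
    using realizable4_block[of 5 a 3 "3 - b" b b c d] K5[of "a - (18 - b)" 0 c d] that
    by (simp add: choose_2_numeral)
  have exact: "realizable4 8 a b c d" if "15 \<le> a" "a \<le> 18" "18 \<le> a + b" "a + b + c + d = 28" for a b c d
    using realizable4_block[of 5 a 3 "a - 15" b "18 - a" c d] K5[of 0 "b - (18 - a)" c d] that
    by (simp add: choose_2_numeral)
  have first: "realizable4 8 a b c d" if "15 \<le> a" "a \<le> 18 \<and> 18 \<le> a + b \<or> 19 \<le> a \<and> b \<le> 3" "a + b + c + d = 28" for a b c d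
    using small[of a b c d] exact[of a b c d] that by auto
  \<comment> \<open>If \<open>a \<ge> 19\<close>, the others sum to at most 9, so one is at most 3.
    If \<open>a \<le> 18\<close>, they sum to at least 10, so one is at least 4 and covers the
    \<open>18 - a\<close> free triangle edges.\<close>
  consider "a \<le> 18 \<and> 18 \<le> a + b \<or> 19 \<le> a \<and> b \<le> 3" | "a \<le> 18 \<and> 18 \<le> a + c \<or> 19 \<le> a \<and> c \<le> 3"
    | "a \<le> 18 \<and> 18 \<le> a + d \<or> 19 \<le> a \<and> d \<le> 3"
    using assms by linarith
  then show ?thesis
    using first[of a b c d] first[of a c b d] first[of a d b c] assms realizable4_perm
    by cases (auto simp: add.commute add.left_commute)
qed

text \<open>If some count lies in \<open>?X\<close>, one of the two preceding constructions applies
  with that colour first. Otherwise all counts are among 1, 2, 3, 4, 8, 9, 14, and only eight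
  decreasing quadruples have sum 28.\<close>

lemma realizable4_8:
  assumes "a + b + c + d = 28"
  shows "realizable4 8 a b c d"
proof (rule realizable4_sorted_cases[where P = "\<lambda>a b c d. a + b + c + d = 28"])
  fix a b c d :: nat
  assume ord: "b \<le> a" "c \<le> b" "d \<le> c" and sum: "a + b + c + d = 28"
  let ?X = "{0, 5, 6, 7, 10, 11, 12, 13} \<union> {15..} :: nat set"
  have special: "realizable4 8 a b c d" if "a \<in> ?X" "a + b + c + d = 28" for a b c d
    using realizable4_8_if_exact[of a b c d] realizable4_8_if_ge_15[of a b c d] that by auto
  have K5: "realizable4 5 4 3 2 1"
    using realizable4_peel[of 4 4 3 2 1] realizable4_three_4[of 3 2 1] by (simp add: realizable4_perm)
  show "realizable4 8 a b c d"
  proof (cases "a \<in> ?X \<or> b \<in> ?X \<or> c \<in> ?X \<or> d \<in> ?X")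
    case True
    then show ?thesis
      using special[of a b c d] special[of b a c d] special[of c a b d] special[of d a b c] sum realizable4_perm
      by (elim disjE) (auto simp del: Un_iff simp: add.commute add.left_commute)
  next
    case False
    then have vals: "a \<in> {1, 2, 3, 4, 8, 9, 14}" "b \<in> {1, 2, 3, 4, 8, 9, 14}"
      "c \<in> {1, 2, 3, 4, 8, 9, 14}" "d \<in> {1, 2, 3, 4, 8, 9, 14}"
      by (simp; presburger)+
    \<comment> \<open>All of these but \<open>(14, 8, 3, 3)\<close> are reduced by stars with 7, 6 and 5 edges to the sizes 4, 3, 2, 1.\<close>
    have "(a, b, c, d) = (14, 9, 4, 1) \<or> (a, b, c, d) = (14, 9, 3, 2) \<or> (a, b, c, d) = (14, 8, 4, 2)
      \<or> (a, b, c, d) = (14, 8, 3, 3) \<or> (a, b, c, d) = (9, 9, 9, 1) \<or> (a, b, c, d) = (9, 9, 8, 2)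
      \<or> (a, b, c, d) = (9, 8, 8, 3) \<or> (a, b, c, d) = (8, 8, 8, 4)"
    proof -
      have c: "c = 1 \<or> c = 2 \<or> c = 3 \<or> c = 4 \<or> c = 8 \<or> c = 9" using vals(3) ord sum by auto
      have a: "a = 14 \<or> a = 9 \<or> a = 8" using vals(1) ord sum by auto
      moreover have "b = 9 \<or> b = 8" using vals(2) ord sum a c by auto
      moreover note c
      moreover have "d = 28 - (a + b + c)" using sum by simp
      ultimately show ?thesis using ord vals(4) sum by (elim disjE) simp_all
    qed
    then show ?thesis
    proof (elim disjE)
      assume "(a, b, c, d) = (14, 9, 4, 1)"
      then show ?thesis using K5 realizable4_peel[of 5 7 3 4 1] realizable4_peel2[of 6 7 9 4 1]
          realizable4_peel[of 7 14 9 4 1] by (simp add: realizable4_perm)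
    next
      assume "(a, b, c, d) = (14, 9, 3, 2)"
      then show ?thesis using K5 realizable4_peel2[of 5 1 9 3 2] realizable4_peel[of 6 7 9 3 2]
          realizable4_peel[of 7 14 9 3 2] by (simp add: realizable4_perm)
    next
      assume "(a, b, c, d) = (14, 8, 4, 2)"
      then show ?thesis using K5 realizable4_peel[of 5 8 1 4 2] realizable4_peel[of 6 14 1 4 2]
          realizable4_peel2[of 7 14 8 4 2] by (simp add: realizable4_perm)
    next
      assume "(a, b, c, d) = (14, 8, 3, 3)"
      \<comment> \<open>A star with seven edges of the second colour and a \<open>K(2, 5)\<close> of
        the first, with the last edge of the second inside the pair, reduce this case to three
        colours.\<close>
      have "realizable4 5 4 0 3 3"
        using realizable4_three[of 5 4 3 3] by (simp add: choose_2_numeral realizable4_perm)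
      then show ?thesis using \<open>(a, b, c, d) = (14, 8, 3, 3)\<close> realizable4_block[of 5 14 2 0 1 1 3 3]
          realizable4_peel2[of 7 14 8 3 3] by (simp add: choose_2_numeral)
    next
      assume "(a, b, c, d) = (9, 9, 9, 1)"
      then show ?thesis using K5 realizable4_peel3[of 5 2 3 9 1] realizable4_peel2[of 6 2 9 9 1]
          realizable4_peel[of 7 9 9 9 1] by (simp add: realizable4_perm)
    next
      assume "(a, b, c, d) = (9, 9, 8, 2)"
      then show ?thesis using K5 realizable4_peel[of 5 9 3 1 2] realizable4_peel2[of 6 9 9 1 2]
          realizable4_peel3[of 7 9 9 8 2] by (simp add: realizable4_perm)
    next
      assume "(a, b, c, d) = (9, 8, 8, 3)"
      then show ?thesis using K5 realizable4_peel[of 5 9 1 2 3] realizable4_peel3[of 6 9 1 8 3]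
          realizable4_peel2[of 7 9 8 8 3] by (simp add: realizable4_perm)
    next
      assume "(a, b, c, d) = (8, 8, 8, 4)"
      then show ?thesis using K5 realizable4_peel3[of 5 1 2 8 4] realizable4_peel2[of 6 1 8 8 4]
          realizable4_peel[of 7 8 8 8 4] by (simp add: realizable4_perm)
    qed
  qed
qed (use assms in auto)

lemma realizable4_four:
  assumes "8 \<le> n" "a + b + c + d = n choose 2"
  shows "realizable4 n a b c d"
  using assms
proof (induction n arbitrary: a b c d rule: dec_induct)
  case base
  then show ?case by (intro realizable4_8) (simp add: choose_2_numeral)
next
  case (step n)
  have s: "a + b + c + d = (n choose 2) + n" using step.prems by (simp add: choose_2_Suc)
  have "4 * n \<le> (n choose 2) + n + 3"
  proof -
    have "n * 7 \<le> n * (n - 1)" using step.hyps by (intro mult_le_mono) auto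
    then show ?thesis using double_choose_2[of n] step.hyps by linarith
  qed
  then consider "n \<le> a" | "n \<le> b" | "n \<le> c" | "n \<le> d" using s by linarith
  then show ?case
  proof cases
    case 1
    then show ?thesis using step.IH[of "a - n" b c d] s by (intro realizable4_peel) auto
  next
    case 2
    then show ?thesis using step.IH[of a "b - n" c d] s by (intro realizable4_peel2) auto
  next
    case 3
    then show ?thesis using step.IH[of a b "c - n" d] s by (intro realizable4_peel3) auto
  next
    case 4
    then show ?thesis using step.IH[of a b c "d - n"] s by (intro realizable4_peel4) auto
  qed
qed

section \<open>The threshold\<close>

text \<open>A partition leaves the values outside 1, ..., \<open>k\<close> arbitrary, whereas
  \<open>realizable\<close> reads all of them; setting them to 0 expresses that only the
  \<open>k\<close> colours occur.\<close>

definition restrict_colors :: "nat \<Rightarrow> (nat \<Rightarrow> nat) \<Rightarrow> nat \<Rightarrow> nat" where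
  "restrict_colors k e i = (if i \<in> {1..k} then e i else 0)"

lemma gallai_coloring_iff_realizable:
  "(\<exists>c. gallai_coloring k n c \<and> realizes k n c e) \<longleftrightarrow> realizable n (restrict_colors k e)"
proof
  assume "\<exists>c. gallai_coloring k n c \<and> realizes k n c e"
  then obtain c where c: "gallai_coloring k n c" "realizes k n c e" by blast
  have "card (color_class {1..n} c i) = restrict_colors k e i" for i
  proof (cases "i \<in> {1..k}")
    case True
    then show ?thesis using c(2)
      by (simp add: realizes_def color_class_def complete_edges_def restrict_colors_def)
  next
    case False
    then have "color_class {1..n} c i = {}"
      using c(1) by (auto simp: gallai_coloring_def color_class_def complete_edges_def)
    then show ?thesis using False by (auto simp: restrict_colors_def)
  qed
  moreover have "gallai_on {1..n} c" using c(1) by (simp add: gallai_coloring_def gallai_on_def)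
  ultimately show "realizable n (restrict_colors k e)" unfolding realizable_def realizable_on_def by blast
next
  assume "realizable n (restrict_colors k e)"
  then obtain c where c: "gallai_on {1..n} c" "\<And>i. card (color_class {1..n} c i) = restrict_colors k e i"
    unfolding realizable_def realizable_on_def by blast
  have "c \<in> complete_edges n \<rightarrow> {1..k}"
  proof
    fix a assume "a \<in> complete_edges n"
    then have "a \<in> color_class {1..n} c (c a)" by (simp add: complete_edges_def color_class_def)
    then have "card (color_class {1..n} c (c a)) \<noteq> 0" by auto
    then show "c a \<in> {1..k}" using c(2)[of "c a"] by (metis restrict_colors_def)
  qed
  then have "gallai_coloring k n c" using c(1) by (simp add: gallai_coloring_def gallai_on_def)
  moreover have "realizes k n c e"
    using c(2) by (auto simp: realizes_def color_class_def complete_edges_def restrict_colors_def)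
  ultimately show "\<exists>c. gallai_coloring k n c \<and> realizes k n c e" by blast
qed

lemma gallai_threshold_iff:
  "gallai_threshold k m \<longleftrightarrow>
     0 < m \<and> (\<forall>n\<ge>m. \<forall>e. edge_partition k n e \<longrightarrow> realizable n (restrict_colors k e))"
  by (simp add: gallai_threshold_def gallai_coloring_iff_realizable)

text \<open>Some threshold \<open>m\<close> is assumed so that the least one exists and
  \<open>g k\<close> is itself a threshold.\<close>

lemma less_g_if_not_realizable:
  assumes "gallai_threshold k m" "edge_partition k n e" "\<not> realizable n (restrict_colors k e)"
  shows "n < g k"
proof -
  have "gallai_threshold k (g k)" unfolding g_def by (rule LeastI) (rule assms(1))
  then show ?thesis using assms(2,3) unfolding gallai_threshold_iff by (meson not_le)
qed

lemma g_le: "gallai_threshold k m \<Longrightarrow> g k \<le> m"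
  unfolding g_def by (rule Least_le)

lemma gallai_threshold_upper:
  assumes "3 \<le> k"
  shows "gallai_threshold k (8 * k\<^sup>2 + 1)"
  unfolding gallai_threshold_iff
proof (intro conjI allI impI)
  fix n e assume "8 * k\<^sup>2 + 1 \<le> n" "edge_partition k n e"
  then show "realizable n (restrict_colors k e)"
    using assms
    by (intro realizable_if_large[of "{1..k}" k])
      (auto simp: edge_partition_def restrict_colors_def)
qed simp

section \<open>Lower bounds and exact values of \<open>g\<close>\<close>

lemma bounded_partition_exists:
  fixes k N M :: nat
  assumes "k \<le> N" "N \<le> k * M"
  shows "\<exists>e. (\<forall>i\<in>{1..k}. 0 < e i \<and> e i \<le> M) \<and> (\<Sum>i=1..k. e i) = N"
  using assms
proof (induction k arbitrary: N)
  case 0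
  then show ?case by simp
next
  case (Suc k)
  have M: "0 < M" using Suc.prems by (cases M) auto
  \<comment> \<open>The last part is chosen greedily, but leaves at least 1 for each of the other
    \<open>k\<close> parts.\<close>
  define x where "x = min M (N - k)"
  have x: "0 < x" "x \<le> M" "x \<le> N" using Suc.prems M by (auto simp: x_def)
  have "k \<le> N - x" using Suc.prems by (auto simp: x_def)
  moreover have "N - x \<le> k * M"
  proof (cases "N - k \<le> M")
    case True
    have "k \<le> k * M" using M by simp
    moreover have "N - x = k" using True Suc.prems by (simp add: x_def)
    ultimately show ?thesis by simp
  next
    case False
    then show ?thesis using Suc.prems by (simp add: x_def min_def)
  qed
  ultimately obtain e where e: "\<forall>i\<in>{1..k}. 0 < e i \<and> e i \<le> M" "(\<Sum>i=1..k. e i) = N - x"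
    using Suc.IH by blast
  have "(\<Sum>i=1..Suc k. (e(Suc k := x)) i) = N"
  proof -
    have "(\<Sum>i=1..k. (e(Suc k := x)) i) = (\<Sum>i=1..k. e i)" by (intro sum.cong) auto
    then show ?thesis using e(2) x(3) by simp
  qed
  moreover have "\<forall>i\<in>{1..Suc k}. 0 < (e(Suc k := x)) i \<and> (e(Suc k := x)) i \<le> M"
    using e(1) x by auto
  ultimately show ?case by blast
qed

text \<open>On \<open>n = 2 * k - 3\<close> vertices all edges can be distributed to
  \<open>k\<close> colours with at most \<open>n - 2\<close> each, while a Gallai colouring has a
  colour with at least \<open>n - 1\<close> edges.\<close>

lemma g_lower:
  assumes "3 \<le> k"
  shows "2 * k - 2 \<le> g k"
proof -
  obtain j where k: "k = j + 3" using assms by (metis le_add_diff_inverse2)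
  define n where "n = 2 * j + 3"
  have ch: "n choose 2 = (2 * j + 3) * (j + 1)"
    using double_choose_2[of n] by (simp add: n_def algebra_simps)
  obtain e where e: "\<forall>i\<in>{1..k}. 0 < e i \<and> e i \<le> 2 * j + 1" "(\<Sum>i=1..k. e i) = n choose 2"
    using bounded_partition_exists[of k "n choose 2" "2 * j + 1"] unfolding ch k
    by (auto simp: algebra_simps)
  have "\<not> realizable n (restrict_colors k e)"
    using e(1) by (intro not_realizable_if_small) (auto simp: restrict_colors_def n_def less_Suc_eq_le)
  moreover have "edge_partition k n e" using e by (simp add: edge_partition_def)
  ultimately have "n < g k" using less_g_if_not_realizable gallai_threshold_upper[OF assms] by blast
  then show ?thesis by (simp add: n_def k)
qed

lemma restrict_colors_3: "restrict_colors 3 e = four_colors (e 1) (e 2) (e 3) 0"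
  by (auto simp: restrict_colors_def four_colors_def fun_eq_iff)

lemma restrict_colors_4: "restrict_colors 4 e = four_colors (e 1) (e 2) (e 3) (e 4)"
  by (auto simp: restrict_colors_def four_colors_def fun_eq_iff)

lemma sum_to_3: "sum e {Suc 0..3} = e (Suc 0) + e 2 + (e 3 :: nat)"
  by (simp add: eval_nat_numeral)

lemma sum_to_4: "sum e {Suc 0..4} = e (Suc 0) + e 2 + e 3 + (e 4 :: nat)"
  by (simp add: eval_nat_numeral)

lemma g_3: "g 3 = 5"
proof (rule antisym)
  have th: "gallai_threshold 3 5"
    unfolding gallai_threshold_iff restrict_colors_3
    using realizable4_three by (auto simp: edge_partition_def sum_to_3 realizable4_def)
  then show "g 3 \<le> 5" by (rule g_le)
  \<comment> \<open>On four vertices (2, 2, 2) gives no colour the three edges that some colour must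
    have.\<close>
  have "edge_partition 3 4 (\<lambda>_. 2)" by (simp add: edge_partition_def choose_2_numeral)
  moreover have "\<not> realizable 4 (restrict_colors 3 (\<lambda>_. 2))"
    by (intro not_realizable_if_small) (auto simp: restrict_colors_def)
  ultimately show "5 \<le> g 3" using less_g_if_not_realizable[OF th] by fastforce
qed

lemma g_4: "g 4 = 8"
proof (rule antisym)
  have th: "gallai_threshold 4 8"
    unfolding gallai_threshold_iff restrict_colors_4
    using realizable4_four by (auto simp: edge_partition_def sum_to_4 realizable4_def)
  then show "g 4 \<le> 8" by (rule g_le)
  \<comment> \<open>The obstruction (9, 4, 4, 4) on seven vertices, whose 21 edges it uses
    up.\<close>
  define e :: "nat \<Rightarrow> nat" where "e = (\<lambda>_. 4)(1 := 9)"
  have "edge_partition 4 7 e" by (simp add: edge_partition_def choose_2_numeral sum_to_4 e_def)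
  moreover have "\<not> realizable 7 (restrict_colors 4 e)"
    using not_realizable_9444[of 1 2 3 4] by (simp add: restrict_colors_4 four_colors_def e_def)
  ultimately show "8 \<le> g 4" using less_g_if_not_realizable[OF th] by fastforce
qed

theorem theorem5:
  "(\<forall>k::nat. 3 \<le> k \<longrightarrow>
      (\<exists>m. gallai_threshold k m) \<and> 2 * k - 2 \<le> g k \<and> g k \<le> 8 * k ^ 2 + 1) \<and>
   g 3 = 5 \<and> g 4 = 8"
  using gallai_threshold_upper g_le g_lower g_3 g_4 by blast

end
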